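(* For each $\varepsilon>0$, the set $\mathrm{graph}(c+v^\varepsilon_x)$ is backward invariant under the discount Hamiltonian flow: $\phi^s_{H,c,\varepsilon}(\mathrm{graph}(c+v^\varepsilon_x))\subset\mathrm{graph}(c+v^\varepsilon_x)$ for all $s\le 0$.
   Context: $H:\mathbb{T}^n\times\mathbb{R}^n\to\mathbb{R}$ is $C^2$, $H_{pp}$ is positive definite, $H(x,p)/|p|\to+\infty$ as $|p|\to\infty$ uniformly in $x$. $c\in\mathbb{R}^n$ is fixed and $h(c)$ is the unique constant for which $H(x,c+v_x)=h(c)$ has a viscosity solution on $\mathbb{T}^n$. For $\varepsilon>0$, $v^\varepsilon$ is the unique viscosity solution of $\varepsilon v^\varepsilon+H(x,c+v^\varepsilon_x)=h(c)$ on $\mathbb{T}^n$ (Lipschitz). $\mathrm{graph}(c+v^\varepsilon_x):=\{(x,c+v^\varepsilon_x(x)):x\in\mathbb{T}^n,\ v^\varepsilon\text{ differentiable at }x\}$. $\phi^s_{H,c,\varepsilon}$ is the flow on $\mathbb{T}^n\times\mathbb{R}^n$ of $x'=H_p(x,p)$, $p'=-H_x(x,p)+\varepsilon c-\varepsilon p$. *)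

theory Defs
  imports "HOL-Analysis.Analysis"
begin

text \<open>The torus T^n is represented by Z^n-periodic objects on real^'n.\<close>

definition int_vec :: "real ^ 'n \<Rightarrow> bool" where
  "int_vec k \<longleftrightarrow> (\<forall>i. k $ i \<in> \<int>)"

definition periodic_fun :: "(real ^ 'n \<Rightarrow> 'b) \<Rightarrow> bool" where
  "periodic_fun u \<longleftrightarrow> (\<forall>x k. int_vec k \<longrightarrow> u (x + k) = u x)"

definition C1_map :: "('a::real_normed_vector \<Rightarrow> 'b::real_normed_vector) \<Rightarrow> bool" where
  "C1_map f \<longleftrightarrow> (\<exists>f'. (\<forall>z. (f has_derivative blinfun_apply (f' z)) (at z)) \<and> continuous_on UNIV f')"

definition C2_map :: "('a::real_normed_vector \<Rightarrow> 'b::real_normed_vector) \<Rightarrow> bool" where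
  "C2_map f \<longleftrightarrow> (\<exists>f'. (\<forall>z. (f has_derivative blinfun_apply (f' z)) (at z)) \<and> C1_map f')"

definition grad :: "(real ^ 'n \<Rightarrow> real) \<Rightarrow> real ^ 'n \<Rightarrow> real ^ 'n" where
  "grad u x = (\<chi> i. frechet_derivative u (at x) (axis i 1))"

definition Hx :: "(real ^ 'n \<Rightarrow> real ^ 'n \<Rightarrow> real) \<Rightarrow> real ^ 'n \<Rightarrow> real ^ 'n \<Rightarrow> real ^ 'n" where
  "Hx H x p = grad (\<lambda>y. H y p) x"

definition Hp :: "(real ^ 'n \<Rightarrow> real ^ 'n \<Rightarrow> real) \<Rightarrow> real ^ 'n \<Rightarrow> real ^ 'n \<Rightarrow> real ^ 'n" where
  "Hp H x p = grad (\<lambda>q. H x q) p"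

definition Hpp_pos_def :: "(real ^ 'n \<Rightarrow> real ^ 'n \<Rightarrow> real) \<Rightarrow> bool" where
  "Hpp_pos_def H \<longleftrightarrow> (\<forall>x p w. w \<noteq> 0 \<longrightarrow>
      frechet_derivative (\<lambda>q. Hp H x q) (at p) w \<bullet> w > 0)"

definition superlinear :: "(real ^ 'n \<Rightarrow> real ^ 'n \<Rightarrow> real) \<Rightarrow> bool" where
  "superlinear H \<longleftrightarrow> (\<forall>M. \<exists>R. \<forall>x p. norm p \<ge> R \<longrightarrow> H x p \<ge> M * norm p)"

definition visc_sub :: "(real ^ 'n \<Rightarrow> real \<Rightarrow> real ^ 'n \<Rightarrow> real) \<Rightarrow> (real ^ 'n \<Rightarrow> real) \<Rightarrow> bool" where
  "visc_sub F u \<longleftrightarrow> continuous_on UNIV u \<and>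
     (\<forall>\<phi> x0 g. C1_map \<phi> \<and> (\<phi> has_derivative (\<lambda>h. g \<bullet> h)) (at x0) \<and>
        (\<forall>\<^sub>F x in at x0. u x - \<phi> x \<le> u x0 - \<phi> x0) \<longrightarrow> F x0 (u x0) g \<le> 0)"

definition visc_super :: "(real ^ 'n \<Rightarrow> real \<Rightarrow> real ^ 'n \<Rightarrow> real) \<Rightarrow> (real ^ 'n \<Rightarrow> real) \<Rightarrow> bool" where
  "visc_super F u \<longleftrightarrow> continuous_on UNIV u \<and>
     (\<forall>\<phi> x0 g. C1_map \<phi> \<and> (\<phi> has_derivative (\<lambda>h. g \<bullet> h)) (at x0) \<and>
        (\<forall>\<^sub>F x in at x0. u x - \<phi> x \<ge> u x0 - \<phi> x0) \<longrightarrow> F x0 (u x0) g \<ge> 0)"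

definition visc_sol :: "(real ^ 'n \<Rightarrow> real \<Rightarrow> real ^ 'n \<Rightarrow> real) \<Rightarrow> (real ^ 'n \<Rightarrow> real) \<Rightarrow> bool" where
  "visc_sol F u \<longleftrightarrow> visc_sub F u \<and> visc_super F u"

definition torus_visc_sol :: "(real ^ 'n \<Rightarrow> real \<Rightarrow> real ^ 'n \<Rightarrow> real) \<Rightarrow> (real ^ 'n \<Rightarrow> real) \<Rightarrow> bool" where
  "torus_visc_sol F u \<longleftrightarrow> periodic_fun u \<and> visc_sol F u"

definition graph_grad :: "real ^ 'n \<Rightarrow> (real ^ 'n \<Rightarrow> real) \<Rightarrow> ((real ^ 'n) \<times> (real ^ 'n)) set" where
  "graph_grad c v = {(x, c + grad v x) | x. v differentiable (at x)}"

definition disc_field :: "(real ^ 'n \<Rightarrow> real ^ 'n \<Rightarrow> real) \<Rightarrow> real ^ 'n \<Rightarrow> real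
     \<Rightarrow> (real ^ 'n) \<times> (real ^ 'n) \<Rightarrow> (real ^ 'n) \<times> (real ^ 'n)" where
  "disc_field H c \<epsilon> z = (Hp H (fst z) (snd z),
       - Hx H (fst z) (snd z) + \<epsilon> *\<^sub>R c - \<epsilon> *\<^sub>R snd z)"

end

theory Submission
  imports Defs
begin

text \<open>
  With \<open>G x q = H x (c + q) - h\<close>, the function \<open>v\<close> solves \<open>\<epsilon> v + G x (Dv) = 0\<close>. Its sup- and
  inf-convolutions satisfy the dynamic programming inequalities over one discrete step of length
  \<open>\<tau>\<close> up to a small error: the former for every velocity, the latter for a suitable velocity
  \<open>Gp x p\<close>. Iterating the latter backwards from \<open>x\<close> gives a discrete orbit along which \<open>v\<close> is nearly
  calibrated; comparing it with perturbed orbits gives a first variation inequality, in which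
  uniform convexity of \<open>G\<close> in the momentum controls the quadratic remainder.

  If \<open>v\<close> is differentiable at \<open>x\<close>, varying all nodes except the last one forces the costates to
  satisfy the discretised adjoint equation with value \<open>Dv(x)\<close> at \<open>x\<close>, up to an error that vanishes
  in mean square as \<open>\<tau> \<rightarrow> 0\<close>. By Gronwall's inequality the orbits converge to the given
  characteristic \<open>(\<xi>, \<rho>)\<close>. Varying the last node then shows that a quadratic with slope \<open>\<rho>\<close> touches
  \<open>v\<close> from below at the endpoint, and semiconcavity of \<open>v\<close> (again from the first variation
  inequality) upgrades this to differentiability with gradient \<open>\<rho>\<close>.
\<close>

section \<open>Quadratic penalties and discrete summation\<close>

text \<open>The viscosity inequalities speak only about points where a test function touches
  \<open>v\<close>, while calibration is a statement about \<open>v\<close> along a whole curve. The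
  quadratic convolutions bridge this: near every point they supply a touching point, hence a
  costate. The price per unit time is of order \<delta> + \<tau> / \<delta>, so \<delta> is tied to
  \<open>sqrt \<tau>\<close>, and an orbit over a fixed horizon is optimal up to
  O(\<open>sqrt \<tau>\<close>). No curve has to be extracted by compactness: the limit is given in
  advance, so convergence is a stability question for one discretised ODE system. Differentiability
  at the start gives only an o-estimate, so the perturbations there get an amplitude r that is fixed
  before \<tau> tends to 0 and made small afterwards. Estimates on the Hamiltonian are uniform only
  for bounded momenta. One ball of radius \<open>R\<close> must therefore hold both the costates of
  the convolutions (at most \<open>2 * K\<close>) and the momenta of the given
  characteristic.\<close>

lemma quadratic_penalty_min_attained:
  fixes f :: "'a::euclidean_space \<Rightarrow> real"
  assumes lip: "\<And>x y. \<bar>f x - f y\<bar> \<le> K * norm (x - y)" and "0 < \<delta>" "0 \<le> K"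
  shows "\<exists>y. norm (y - x) \<le> 2 * K * \<delta> \<and>
    (\<forall>z. f y + (norm (y - x))\<^sup>2 / (2 * \<delta>) \<le> f z + (norm (z - x))\<^sup>2 / (2 * \<delta>))"
proof -
  let ?g = "\<lambda>z. f z + (norm (z - x))\<^sup>2 / (2 * \<delta>)"
  have "K-lipschitz_on UNIV f"
    using lip \<open>0 \<le> K\<close> by (auto intro!: lipschitz_onI simp: dist_norm)
  then have "continuous_on UNIV f"
    by (rule lipschitz_on_continuous_on)
  then have cont: "continuous_on (cball x (2 * K * \<delta>)) ?g"
    using \<open>0 < \<delta>\<close> by (intro continuous_intros) (auto elim: continuous_on_subset)
  have "x \<in> cball x (2 * K * \<delta>)"
    using assms by simp
  then obtain y where y: "y \<in> cball x (2 * K * \<delta>)"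
    and ymin: "\<forall>z\<in>cball x (2 * K * \<delta>). ?g y \<le> ?g z"
    using continuous_attains_inf[OF compact_cball _ cont] by blast
  \<comment> \<open>The radius \<open>2 * K * \<delta>\<close> is where the penalty overtakes the
    Lipschitz growth of \<open>f\<close>. Beyond it no point beats the centre \<open>x\<close>, so
    the minimum over the ball is global.\<close>
  have "?g y \<le> ?g z" for z
  proof (cases "norm (z - x) \<le> 2 * K * \<delta>")
    case True
    then show ?thesis
      using ymin by (auto simp: dist_norm norm_minus_commute)
  next
    case False
    then have "K * norm (z - x) \<le> (norm (z - x) / (2 * \<delta>)) * norm (z - x)"
      using \<open>0 < \<delta>\<close> by (intro mult_right_mono) (auto simp: field_simps)
    then have "K * norm (z - x) \<le> (norm (z - x))\<^sup>2 / (2 * \<delta>)"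
      by (simp add: power2_eq_square)
    then have "f x \<le> ?g z"
      using lip[of z x] by linarith
    moreover have "?g y \<le> f x"
      using bspec[OF ymin \<open>x \<in> cball x (2 * K * \<delta>)\<close>] by simp
    ultimately show ?thesis
      by linarith
  qed
  then show ?thesis
    using y by (intro exI[of _ y]) (auto simp: dist_norm norm_minus_commute)
qed

text \<open>The error terms carry weights \<kappa>^j, which are bounded by 1. The total error is
  thus at most the horizon \<open>N * \<tau>\<close> times \<open>e\<close>, and does not grow with
  the number of steps.\<close>

lemma discounted_iteration:
  fixes a :: "nat \<Rightarrow> real"
  assumes step: "\<And>j. j < N \<Longrightarrow> a j \<le> \<kappa> * a (Suc j) + \<tau> * (l j + e)"
    and "0 \<le> \<kappa>" "\<kappa> \<le> 1" "0 \<le> \<tau>" "0 \<le> e"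
  shows "a 0 \<le> \<kappa> ^ N * a N + (\<Sum>j<N. \<tau> * \<kappa> ^ j * l j) + real N * \<tau> * e"
  using step
proof (induction N)
  case 0
  then show ?case by simp
next
  case (Suc N)
  have "\<kappa> ^ N * a N \<le> \<kappa> ^ N * (\<kappa> * a (Suc N) + \<tau> * (l N + e))"
    using Suc.prems[of N] assms by (intro mult_left_mono) auto
  also have "\<dots> \<le> \<kappa> ^ Suc N * a (Suc N) + \<tau> * \<kappa> ^ N * l N + \<tau> * e"
  proof -
    have "\<kappa> ^ N * (\<tau> * e) \<le> 1 * (\<tau> * e)"
      using assms by (intro mult_right_mono power_le_one) auto
    then show ?thesis
      by (simp add: algebra_simps)
  qed
  finally show ?case
    using Suc.IH Suc.prems by (fastforce simp: algebra_simps)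
qed

text \<open>Summation by parts: the forces \<open>g\<close>, paired with displacements, become
  accumulated forces paired with the velocity perturbations \<omega>. Only the last displacement
  survives as a boundary term.\<close>

lemma abel_summation:
  fixes g \<omega> \<eta> :: "nat \<Rightarrow> 'a::real_inner"
  assumes "\<And>j. j < N \<Longrightarrow> \<eta> j = \<eta> (Suc j) + \<tau> *\<^sub>R \<omega> j"
  shows "(\<Sum>j<N. g j \<bullet> \<eta> j) = (\<Sum>j<N. g j) \<bullet> \<eta> N + (\<Sum>i<N. \<tau> * (\<omega> i \<bullet> (\<Sum>j<Suc i. g j)))"
  using assms
proof (induction N)
  case 0
  then show ?case by simp
next
  case (Suc N)
  have "(\<Sum>j<Suc N. g j \<bullet> \<eta> j) = (\<Sum>j<Suc N. g j) \<bullet> \<eta> N + (\<Sum>i<N. \<tau> * (\<omega> i \<bullet> (\<Sum>j<Suc i. g j)))"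
    using Suc.IH[OF Suc.prems] by (simp add: inner_add_left)
  then show ?case
    using arg_cong[OF Suc.prems[of N], of "\<lambda>y. (\<Sum>j<Suc N. g j) \<bullet> y"]
    unfolding sum.lessThan_Suc[of "\<lambda>i. \<tau> * _ i"]
    by (simp only: inner_add_right inner_scaleR_right inner_commute[of "\<omega> N"] lessI)
qed

text \<open>The bound concerns the \<tau>-weighted sum and not the single terms, because in the
  application \<theta> contains the costate defects, which are small only on average.\<close>

lemma discrete_gronwall:
  fixes \<Delta> \<theta> :: "nat \<Rightarrow> real"
  assumes step: "\<And>i. i < N \<Longrightarrow> \<Delta> i \<le> b * (\<tau> * (\<Sum>j<i. \<Delta> j)) + \<theta> i"
    and nonneg: "\<And>i. 0 \<le> \<theta> i" "0 \<le> b" "0 \<le> \<tau>"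
  shows "\<tau> * (\<Sum>j<N. \<Delta> j) \<le> exp (b * (real N * \<tau>)) * (\<tau> * (\<Sum>j<N. \<theta> j))"
proof -
  have "\<tau> * (\<Sum>j<N. \<Delta> j) \<le> (1 + b * \<tau>) ^ N * (\<tau> * (\<Sum>j<N. \<theta> j))"
    using step
  proof (induction N)
    case 0
    then show ?case by simp
  next
    case (Suc N)
    have le1: "1 \<le> (1 + b * \<tau>) ^ Suc N"
      using nonneg by (intro one_le_power) auto
    have "\<tau> * (\<Sum>j<Suc N. \<Delta> j) \<le> \<tau> * (\<Sum>j<N. \<Delta> j) + \<tau> * (b * (\<tau> * (\<Sum>j<N. \<Delta> j)) + \<theta> N)"
      using mult_left_mono[OF Suc.prems[of N] \<open>0 \<le> \<tau>\<close>] by (simp add: distrib_left)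
    also have "\<dots> = (1 + b * \<tau>) * (\<tau> * (\<Sum>j<N. \<Delta> j)) + \<tau> * \<theta> N"
      by (simp add: algebra_simps)
    also have "\<dots> \<le> (1 + b * \<tau>) * ((1 + b * \<tau>) ^ N * (\<tau> * (\<Sum>j<N. \<theta> j))) + (1 + b * \<tau>) ^ Suc N * (\<tau> * \<theta> N)"
    proof (intro add_mono mult_left_mono)
      show "\<tau> * (\<Sum>j<N. \<Delta> j) \<le> (1 + b * \<tau>) ^ N * (\<tau> * (\<Sum>j<N. \<theta> j))"
        using Suc by simp
      show "\<tau> * \<theta> N \<le> (1 + b * \<tau>) ^ Suc N * (\<tau> * \<theta> N)"
        using mult_right_mono[OF le1, of "\<tau> * \<theta> N"] nonneg by simp
    qed (use nonneg in auto)
    also have "\<dots> = (1 + b * \<tau>) ^ Suc N * (\<tau> * (\<Sum>j<Suc N. \<theta> j))"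
      by (simp add: algebra_simps)
    finally show ?case .
  qed
  also have "\<dots> \<le> exp (b * (real N * \<tau>)) * (\<tau> * (\<Sum>j<N. \<theta> j))"
  proof (intro mult_right_mono)
    have "(1 + b * \<tau>) ^ N \<le> exp (b * \<tau>) ^ N"
      using nonneg by (intro power_mono exp_ge_add_one_self) auto
    also have "\<dots> = exp (b * (real N * \<tau>))"
      by (simp add: exp_of_nat_mult[symmetric] algebra_simps)
    finally show "(1 + b * \<tau>) ^ N \<le> exp (b * (real N * \<tau>))" .
    show "0 \<le> \<tau> * (\<Sum>j<N. \<theta> j)"
      using nonneg by (simp add: sum_nonneg)
  qed
  finally show ?thesis .
qed

lemma norm_sum_telescope_le:
  fixes a b :: "nat \<Rightarrow> 'a::real_normed_vector"
  assumes "\<And>j. j < i \<Longrightarrow> norm (a (Suc j) - a j - b j) \<le> B"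
  shows "norm (a i - a 0 - (\<Sum>j<i. b j)) \<le> real i * B"
proof -
  have "a i - a 0 - (\<Sum>j<i. b j) = (\<Sum>j<i. a (Suc j) - a j - b j)"
    by (simp add: sum_subtractf[of "\<lambda>j. a (Suc j) - a j"] sum_lessThan_telescope)
  also have "norm \<dots> \<le> (\<Sum>j<i. B)"
    using assms by (intro sum_norm_le) auto
  finally show ?thesis by simp
qed

lemma sum_norm_le_scaled:
  fixes f :: "nat \<Rightarrow> 'a::real_normed_vector"
  assumes "\<And>j. j < i \<Longrightarrow> norm (f j) \<le> c" "i \<le> N" "real N * \<tau> \<le> T" "0 \<le> \<tau>" "0 \<le> c"
    and "\<And>j. j < i \<Longrightarrow> \<bar>k j\<bar> \<le> \<tau>"
  shows "norm (\<Sum>j<i. k j *\<^sub>R f j) \<le> T * c"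
proof -
  have "norm (\<Sum>j<i. k j *\<^sub>R f j) \<le> (\<Sum>j<i. \<tau> * c)"
    using assms by (intro sum_norm_le) (auto intro: mult_mono)
  also have "\<dots> = (real i * \<tau>) * c"
    by simp
  also have "\<dots> \<le> T * c"
  proof (intro mult_right_mono)
    have "real i * \<tau> \<le> real N * \<tau>"
      using assms by (intro mult_right_mono) auto
    then show "real i * \<tau> \<le> T"
      using assms by simp
  qed (use assms in auto)
  finally show ?thesis .
qed

section \<open>Elementary differential calculus\<close>

lemma vector_derivative_increment_le:
  fixes f :: "real \<Rightarrow> 'a::real_normed_vector"
  assumes "a \<le> b" "\<And>s. s \<in> {a..b} \<Longrightarrow> (f has_vector_derivative f' s) (at s within {a..b})"
    and "\<And>s. s \<in> {a..b} \<Longrightarrow> norm (f' s) \<le> L"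
  shows "norm (f b - f a) \<le> L * (b - a)"
proof -
  have "norm (f b - f a) \<le> L * norm (b - a)"
  proof (rule differentiable_bound)
    show "(f has_derivative (\<lambda>h. h *\<^sub>R f' s)) (at s within {a..b})" if "s \<in> {a..b}" for s
      using assms(2)[OF that] by (simp add: has_vector_derivative_def)
    show "onorm (\<lambda>h. h *\<^sub>R f' s) \<le> L" if "s \<in> {a..b}" for s
      using assms(3)[OF that] by (intro onorm_le) (simp add: mult.commute[of L] mult_left_mono)
  qed (use assms in auto)
  then show ?thesis
    using \<open>a \<le> b\<close> by simp
qed

lemma has_derivative_of_quadratic_bound:
  fixes f :: "'a::real_inner \<Rightarrow> real"
  assumes "\<And>k. \<bar>f (x + k) - f x - D \<bullet> k\<bar> \<le> B * (norm k)\<^sup>2"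
  shows "(f has_derivative (\<lambda>k. D \<bullet> k)) (at x)"
  unfolding has_derivative_at
proof
  show "bounded_linear ((\<bullet>) D)"
    by (rule bounded_linear_inner_right)
  have "(\<lambda>k. B * norm k) \<midarrow>(0::'a)\<rightarrow> 0"
    by (rule tendsto_mult_right_zero[OF tendsto_norm_zero[OF tendsto_ident_at]])
  then show "(\<lambda>k. norm (f (x + k) - f x - D \<bullet> k) / norm k) \<midarrow>0\<rightarrow> 0"
  proof (rule Lim_null_comparison[rotated])
    show "\<forall>\<^sub>F k in at 0. norm (norm (f (x + k) - f x - D \<bullet> k) / norm k) \<le> B * norm k"
      using assms by (auto simp: eventually_at_filter pos_divide_le_eq power2_eq_square mult.assoc
          intro!: always_eventually)
  qed
qed

section \<open>Discrete near-optimal orbits\<close>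

text \<open>Viscosity solutions enter only through tests with quadratics centred at \<open>x\<close>
  and touching \<open>v\<close> at \<open>y\<close>; \<open>K_le_R\<close> puts the resulting
  momenta into the ball where the bounds on \<open>G\<close> hold. \<open>Gx\<close> and
  \<open>Gp\<close> enter only through the listed inequalities. The last one combines uniform
  convexity in the momentum with a Lipschitz gradient in the position, at the cost of a mixed
  term.\<close>

locale discounted_HJ =
  fixes G :: "'a::euclidean_space \<Rightarrow> 'a \<Rightarrow> real"
    and Gx Gp :: "'a \<Rightarrow> 'a \<Rightarrow> 'a" and v :: "'a \<Rightarrow> real"
    and \<epsilon> K R C \<mu> :: real
  assumes eps_pos: "0 < \<epsilon>" and K_nonneg: "0 \<le> K" and K_le_R: "2 * K \<le> R"
    and C_nonneg: "0 \<le> C" and mu_pos: "0 < \<mu>"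
    and v_lipschitz: "\<bar>v x - v y\<bar> \<le> K * norm (x - y)"
    and proximal_sub: "\<lbrakk>0 < \<delta>;
        \<And>z. v z - (norm (z - x))\<^sup>2 / (2 * \<delta>) \<le> v y - (norm (y - x))\<^sup>2 / (2 * \<delta>)\<rbrakk>
      \<Longrightarrow> \<epsilon> * v y + G y ((1 / \<delta>) *\<^sub>R (y - x)) \<le> 0"
    and proximal_super: "\<lbrakk>0 < \<delta>;
        \<And>z. v y + (norm (y - x))\<^sup>2 / (2 * \<delta>) \<le> v z + (norm (z - x))\<^sup>2 / (2 * \<delta>)\<rbrakk>
      \<Longrightarrow> 0 \<le> \<epsilon> * v y + G y ((1 / \<delta>) *\<^sub>R (x - y))"
    and G_lipschitz: "norm p \<le> R \<Longrightarrow> \<bar>G x p - G y p\<bar> \<le> C * norm (x - y)"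
    and Gx_bounded: "norm p \<le> R \<Longrightarrow> norm (Gx x p) \<le> C"
    and Gp_bounded: "norm p \<le> R \<Longrightarrow> norm (Gp x p) \<le> C"
    and Gx_lipschitz: "\<lbrakk>norm p \<le> R; norm p' \<le> R\<rbrakk>
      \<Longrightarrow> norm (Gx x p - Gx x' p') \<le> C * (norm (x - x') + norm (p - p'))"
    and Gp_lipschitz: "\<lbrakk>norm p \<le> R; norm p' \<le> R\<rbrakk>
      \<Longrightarrow> norm (Gp x p - Gp x' p') \<le> C * (norm (x - x') + norm (p - p'))"
    and G_strongly_convex: "\<lbrakk>norm p \<le> R; norm p' \<le> R\<rbrakk>
      \<Longrightarrow> G x p + Gp x p \<bullet> (p' - p) + Gx x p \<bullet> (x' - x) + \<mu> * (norm (p' - p))\<^sup>2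
          - C * norm (p' - p) * norm (x' - x) - C * (norm (x' - x))\<^sup>2 \<le> G x' p'"
begin

text \<open>Young's inequality absorbs d (a + C b) into \<mu> d^2 and leaves (a + C b)^2 / (4
  \<mu>), which is at most (1 + C^2) / (2 \<mu>) times a^2 + b^2. The extra \<open>C\<close> pays
  for the quadratic error in the position. Here d, a, b are the norms of \<open>p' - p\<close>,
  \<omega> and \<eta>.\<close>

definition M :: real where
  "M = (1 + C\<^sup>2) / (2 * \<mu>) + C"

lemma M_nonneg: "0 \<le> M"
  using C_nonneg mu_pos by (simp add: M_def)

text \<open>The left-hand side is an upper bound for the Lagrangian \<open>L (x + \<eta>) (Gp x p + \<omega>)\<close>
  and the bracket is \<open>L x (Gp x p)\<close>; thus \<open>L\<close> has a quadratic upper expansion, and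
  the Legendre transform itself is never needed.\<close>

lemma lagrangian_expansion:
  assumes p: "norm p \<le> R" and p': "norm p' \<le> R"
  shows "p' \<bullet> (Gp x p + \<omega>) - G (x + \<eta>) p'
    \<le> (p \<bullet> Gp x p - G x p) + p \<bullet> \<omega> - Gx x p \<bullet> \<eta> + M * ((norm \<omega>)\<^sup>2 + (norm \<eta>)\<^sup>2)"
proof -
  define d where "d = norm (p' - p)"
  define a where "a = norm \<omega>"
  define b where "b = norm \<eta>"
  have nn: "0 \<le> d" "0 \<le> a" "0 \<le> b"
    by (simp_all add: d_def a_def b_def)
  have G3: "G x p + Gp x p \<bullet> (p' - p) + Gx x p \<bullet> \<eta> + \<mu> * d\<^sup>2 - C * d * b - C * b\<^sup>2 \<le> G (x + \<eta>) p'"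
    using G_strongly_convex[OF p p', of x "x + \<eta>"] by (simp add: d_def b_def)
  have CS: "(p' - p) \<bullet> \<omega> \<le> d * a"
    unfolding d_def a_def by (rule norm_cauchy_schwarz)
  have AM: "d * (a + C * b) \<le> \<mu> * d\<^sup>2 + (a + C * b)\<^sup>2 / (4 * \<mu>)"
  proof -
    have "0 \<le> (2 * \<mu> * d - (a + C * b))\<^sup>2 / (4 * \<mu>)"
      using mu_pos by simp
    also have "\<dots> = \<mu> * d\<^sup>2 - d * (a + C * b) + (a + C * b)\<^sup>2 / (4 * \<mu>)"
      using mu_pos by (simp add: field_simps power2_eq_square)
    finally show ?thesis by simp
  qed
  have "(a + C * b)\<^sup>2 \<le> 2 * (1 + C\<^sup>2) * (a\<^sup>2 + b\<^sup>2)"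
  proof -
    have "0 \<le> (a - C * b)\<^sup>2 + 2 * (C * a)\<^sup>2 + 2 * b\<^sup>2"
      by simp
    then show ?thesis
      by (simp add: power2_eq_square algebra_simps)
  qed
  then have "(a + C * b)\<^sup>2 / (4 * \<mu>) \<le> (2 * (1 + C\<^sup>2) * (a\<^sup>2 + b\<^sup>2)) / (4 * \<mu>)"
    using mu_pos by (intro divide_right_mono) auto
  also have "\<dots> = (1 + C\<^sup>2) / (2 * \<mu>) * (a\<^sup>2 + b\<^sup>2)"
    using mu_pos by (simp add: field_simps)
  finally have Q: "(a + C * b)\<^sup>2 / (4 * \<mu>) + C * b\<^sup>2 \<le> M * (a\<^sup>2 + b\<^sup>2)"
    using mult_nonneg_nonneg[OF C_nonneg zero_le_power2[of a]]
    by (simp add: M_def distrib_right distrib_left)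
  have "p' \<bullet> (Gp x p + \<omega>) = p \<bullet> Gp x p + Gp x p \<bullet> (p' - p) + p \<bullet> \<omega> + (p' - p) \<bullet> \<omega>"
    by (simp add: inner_simps inner_commute)
  then show ?thesis
    using G3 CS AM Q unfolding a_def[symmetric] b_def[symmetric]
    by (simp add: algebra_simps)
qed

section \<open>One-step dynamic programming inequalities\<close>

text \<open>The sup-convolution at \<open>x\<close> is attained at some \<open>y\<close> where the
  subsolution test applies with p = (y - x) / \<delta>. The same \<open>y\<close> is a competitor at
  the shifted centre, and expanding the square produces \<tau> times the pairing of \<open>p\<close>
  with \<open>w\<close>. The number \<open>l\<close> stands in for the Lagrangian. The three terms
  of \<open>e\<close> come from the discount term, from moving \<open>G\<close> from
  \<open>y\<close> to \<open>x\<close>, and from the second-order part of the square.\<close>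

lemma subsolution_step:
  assumes "0 < \<delta>" "0 < \<tau>" "0 \<le> W"
  defines "e \<equiv> \<epsilon> * K * \<tau> * W + 2 * C * K * \<delta> + \<tau> * W\<^sup>2 / (2 * \<delta>)"
  shows "\<exists>u. (\<forall>x. v x \<le> u x \<and> u x \<le> v x + 2 * K\<^sup>2 * \<delta>) \<and>
    (\<forall>x w l. norm w \<le> W \<longrightarrow> (\<forall>p. norm p \<le> R \<longrightarrow> p \<bullet> w - G x p \<le> l) \<longrightarrow>
       u x \<le> (1 - \<epsilon> * \<tau>) * u (x - \<tau> *\<^sub>R w) + \<tau> * (l + e))"
proof -
  have "\<exists>y. norm (y - x) \<le> 2 * K * \<delta> \<and>
      (\<forall>z. - v y + (norm (y - x))\<^sup>2 / (2 * \<delta>) \<le> - v z + (norm (z - x))\<^sup>2 / (2 * \<delta>))" for x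
    using v_lipschitz K_nonneg \<open>0 < \<delta>\<close>
    by (intro quadratic_penalty_min_attained) (auto simp: abs_minus_commute)
  then obtain Y where Y: "\<And>x. norm (Y x - x) \<le> 2 * K * \<delta>"
    and Ymin: "\<And>x z. - v (Y x) + (norm (Y x - x))\<^sup>2 / (2 * \<delta>) \<le> - v z + (norm (z - x))\<^sup>2 / (2 * \<delta>)"
    by metis
  define u where "u x = v (Y x) - (norm (Y x - x))\<^sup>2 / (2 * \<delta>)" for x
  have u_ge: "v z - (norm (z - x))\<^sup>2 / (2 * \<delta>) \<le> u x" for x z
    using Ymin[of x z] by (simp add: u_def)
  have u_le: "u x \<le> v (Y x)" for x
    using \<open>0 < \<delta>\<close> by (simp add: u_def)
  have near: "v x \<le> u x \<and> u x \<le> v x + 2 * K\<^sup>2 * \<delta>" for x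
  proof
    show "v x \<le> u x"
      using u_ge[of x x] by simp
    have "K * norm (Y x - x) \<le> K * (2 * K * \<delta>)"
      using Y K_nonneg by (intro mult_left_mono) auto
    then show "u x \<le> v x + 2 * K\<^sup>2 * \<delta>"
      using u_le[of x] v_lipschitz[of "Y x" x] by (simp add: power2_eq_square algebra_simps)
  qed
  have step: "u x \<le> (1 - \<epsilon> * \<tau>) * u (x - \<tau> *\<^sub>R w) + \<tau> * (l + e)"
    if w: "norm w \<le> W" and l: "\<And>p. norm p \<le> R \<Longrightarrow> p \<bullet> w - G x p \<le> l" for x w l
  proof -
    define y where "y = Y x"
    define p where "p = (1 / \<delta>) *\<^sub>R (y - x)"
    define x' where "x' = x - \<tau> *\<^sub>R w"
    have pR: "norm p \<le> R"
    proof -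
      have "norm p = norm (y - x) / \<delta>"
        using \<open>0 < \<delta>\<close> by (simp add: p_def)
      also have "\<dots> \<le> 2 * K"
        using Y[of x] \<open>0 < \<delta>\<close> by (simp add: y_def pos_divide_le_eq)
      finally show ?thesis
        using K_le_R by simp
    qed
    have "\<epsilon> * v y + G y p \<le> 0"
      unfolding p_def y_def
      using u_ge[of _ x, unfolded u_def] \<open>0 < \<delta>\<close> by (intro proximal_sub)
    moreover have "G x p \<le> G y p + 2 * C * K * \<delta>"
    proof -
      have "C * norm (x - y) \<le> C * (2 * K * \<delta>)"
        using Y[of x] C_nonneg by (intro mult_left_mono) (auto simp: y_def norm_minus_commute)
      then show ?thesis
        using G_lipschitz[OF pR, of x y] by (simp add: algebra_simps)
    qed
    moreover have "p \<bullet> w \<le> l + G x p"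
      using l[OF pR] by simp
    ultimately have pw: "p \<bullet> w \<le> l - \<epsilon> * v y + 2 * C * K * \<delta>"
      by linarith
    \<comment> \<open>Translating the maximiser for \<open>x'\<close> by \<tau> w gives a competitor
      for \<open>x\<close> at the same displacement from its centre. The penalties agree and only
      the Lipschitz bound on \<open>v\<close> is paid.\<close>
    have "u x' - K * \<tau> * W \<le> u x"
    proof -
      have "v (Y x' + \<tau> *\<^sub>R w) - (norm (Y x' + \<tau> *\<^sub>R w - x))\<^sup>2 / (2 * \<delta>) \<le> u x"
        by (rule u_ge)
      moreover have "Y x' + \<tau> *\<^sub>R w - x = Y x' - x'"
        by (simp add: x'_def)
      moreover have "\<bar>v (Y x' + \<tau> *\<^sub>R w) - v (Y x')\<bar> \<le> K * norm (\<tau> *\<^sub>R w)"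
        using v_lipschitz[of "Y x' + \<tau> *\<^sub>R w" "Y x'"] by simp
      moreover have "K * norm (\<tau> *\<^sub>R w) \<le> K * (\<tau> * W)"
        using w K_nonneg \<open>0 < \<tau>\<close> by (intro mult_left_mono) auto
      ultimately show ?thesis
        by (simp add: u_def[of x'] algebra_simps)
    qed
    then have "u x' - K * \<tau> * W \<le> v y"
      using u_le[of x] by (simp add: y_def)
    then have "\<epsilon> * (u x' - K * \<tau> * W) \<le> \<epsilon> * v y"
      using eps_pos by simp
    with pw have "p \<bullet> w \<le> l - \<epsilon> * (u x' - K * \<tau> * W) + 2 * C * K * \<delta>"
      by linarith
    then have pw': "\<tau> * (p \<bullet> w) \<le> \<tau> * (l - \<epsilon> * (u x' - K * \<tau> * W) + 2 * C * K * \<delta>)"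
      using \<open>0 < \<tau>\<close> by simp
    have "v y - (norm (y - x'))\<^sup>2 / (2 * \<delta>) \<le> u x'"
      by (rule u_ge)
    moreover have "(norm (y - x'))\<^sup>2 / (2 * \<delta>)
        = (norm (y - x))\<^sup>2 / (2 * \<delta>) + \<tau> * (p \<bullet> w) + \<tau>\<^sup>2 * (norm w)\<^sup>2 / (2 * \<delta>)"
      using \<open>0 < \<delta>\<close> unfolding p_def x'_def power2_norm_eq_inner
      by (simp add: inner_simps inner_commute field_simps power2_eq_square)
    moreover have "\<tau>\<^sup>2 * (norm w)\<^sup>2 / (2 * \<delta>) \<le> \<tau>\<^sup>2 * W\<^sup>2 / (2 * \<delta>)"
      using w \<open>0 < \<delta>\<close> by (intro divide_right_mono mult_left_mono power_mono) auto
    ultimately have "u x \<le> u x' + \<tau> * (p \<bullet> w) + \<tau>\<^sup>2 * W\<^sup>2 / (2 * \<delta>)"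
      by (simp add: u_def[of x] y_def)
    also have "\<dots> \<le> u x' + \<tau> * (l - \<epsilon> * (u x' - K * \<tau> * W) + 2 * C * K * \<delta>) + \<tau>\<^sup>2 * W\<^sup>2 / (2 * \<delta>)"
      using pw' by simp
    also have "\<dots> = (1 - \<epsilon> * \<tau>) * u x' + \<tau> * (l + e)"
      using \<open>0 < \<delta>\<close> by (simp add: e_def field_simps power2_eq_square)
    finally show ?thesis
      by (simp add: x'_def)
  qed
  from near step show ?thesis
    by blast
qed

text \<open>The mirror image, with the inf-convolution and its minimiser. Now the velocity is tied
  to the costate of the convolution: \<open>Gp x (\<pi> x)\<close> is the velocity at which
  \<open>lagrangian_expansion\<close> is centred, so the running costs cancel when this inequality
  is compared with \<open>subsolution_step\<close>.\<close>

lemma supersolution_step: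
  assumes "0 < \<delta>" "0 < \<tau>"
  defines "e \<equiv> \<epsilon> * K * \<tau> * C + 2 * C * K * \<delta> + \<tau> * C\<^sup>2 / (2 * \<delta>)"
  shows "\<exists>u \<pi>. (\<forall>x. v x - 2 * K\<^sup>2 * \<delta> \<le> u x \<and> u x \<le> v x) \<and>
    (\<forall>x. norm (\<pi> x) \<le> 2 * K \<and>
       (1 - \<epsilon> * \<tau>) * u (x - \<tau> *\<^sub>R Gp x (\<pi> x)) + \<tau> * (\<pi> x \<bullet> Gp x (\<pi> x) - G x (\<pi> x) - e) \<le> u x)"
proof -
  have "\<exists>y. norm (y - x) \<le> 2 * K * \<delta> \<and>
      (\<forall>z. v y + (norm (y - x))\<^sup>2 / (2 * \<delta>) \<le> v z + (norm (z - x))\<^sup>2 / (2 * \<delta>))" for x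
    using v_lipschitz K_nonneg \<open>0 < \<delta>\<close>
    by (intro quadratic_penalty_min_attained) auto
  then obtain Y where Y: "\<And>x. norm (Y x - x) \<le> 2 * K * \<delta>"
    and Ymin: "\<And>x z. v (Y x) + (norm (Y x - x))\<^sup>2 / (2 * \<delta>) \<le> v z + (norm (z - x))\<^sup>2 / (2 * \<delta>)"
    by metis
  define u where "u x = v (Y x) + (norm (Y x - x))\<^sup>2 / (2 * \<delta>)" for x
  define \<pi> where "\<pi> x = (1 / \<delta>) *\<^sub>R (x - Y x)" for x
  have u_le: "u x \<le> v z + (norm (z - x))\<^sup>2 / (2 * \<delta>)" for x z
    using Ymin[of x z] by (simp add: u_def)
  have u_ge: "v (Y x) \<le> u x" for x
    using \<open>0 < \<delta>\<close> by (simp add: u_def)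
  have near: "v x - 2 * K\<^sup>2 * \<delta> \<le> u x \<and> u x \<le> v x" for x
  proof
    show "u x \<le> v x"
      using u_le[of x x] by simp
    have "K * norm (Y x - x) \<le> K * (2 * K * \<delta>)"
      using Y K_nonneg by (intro mult_left_mono) auto
    then show "v x - 2 * K\<^sup>2 * \<delta> \<le> u x"
      using u_ge[of x] v_lipschitz[of "Y x" x] by (simp add: power2_eq_square algebra_simps)
  qed
  have pi_le: "norm (\<pi> x) \<le> 2 * K" for x
  proof -
    have "norm (\<pi> x) = norm (Y x - x) / \<delta>"
      using \<open>0 < \<delta>\<close> by (simp add: \<pi>_def norm_minus_commute)
    also have "\<dots> \<le> 2 * K"
      using Y[of x] \<open>0 < \<delta>\<close> by (simp add: pos_divide_le_eq)
    finally show ?thesis .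
  qed
  have step: "(1 - \<epsilon> * \<tau>) * u (x - \<tau> *\<^sub>R Gp x (\<pi> x))
      + \<tau> * (\<pi> x \<bullet> Gp x (\<pi> x) - G x (\<pi> x) - e) \<le> u x" for x
  proof -
    define y where "y = Y x"
    define p where "p = \<pi> x"
    define w where "w = Gp x p"
    define x' where "x' = x - \<tau> *\<^sub>R w"
    have pR: "norm p \<le> R"
      using pi_le[of x] K_le_R by (simp add: p_def)
    have w: "norm w \<le> C"
      using Gp_bounded[OF pR] by (simp add: w_def)
    have "0 \<le> \<epsilon> * v y + G y p"
      unfolding p_def \<pi>_def y_def using Ymin[of x] \<open>0 < \<delta>\<close> by (intro proximal_super) auto
    moreover have "G y p \<le> G x p + 2 * C * K * \<delta>"
    proof -
      have "C * norm (y - x) \<le> C * (2 * K * \<delta>)"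
        using Y[of x] C_nonneg by (intro mult_left_mono) (auto simp: y_def)
      then show ?thesis
        using G_lipschitz[OF pR, of y x] by (simp add: algebra_simps)
    qed
    moreover have "v y \<le> u x' + K * \<tau> * C"
    proof -
      have "u x \<le> v (Y x' + \<tau> *\<^sub>R w) + (norm (Y x' + \<tau> *\<^sub>R w - x))\<^sup>2 / (2 * \<delta>)"
        by (rule u_le)
      moreover have "Y x' + \<tau> *\<^sub>R w - x = Y x' - x'"
        by (simp add: x'_def)
      moreover have "\<bar>v (Y x' + \<tau> *\<^sub>R w) - v (Y x')\<bar> \<le> K * norm (\<tau> *\<^sub>R w)"
        using v_lipschitz[of "Y x' + \<tau> *\<^sub>R w" "Y x'"] by simp
      moreover have "K * norm (\<tau> *\<^sub>R w) \<le> K * (\<tau> * C)"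
        using w K_nonneg \<open>0 < \<tau>\<close> by (intro mult_left_mono) auto
      ultimately have "u x \<le> u x' + K * \<tau> * C"
        by (simp add: u_def[of x'] algebra_simps)
      then show ?thesis
        using u_ge[of x] by (simp add: y_def)
    qed
    then have "\<epsilon> * v y \<le> \<epsilon> * (u x' + K * \<tau> * C)"
      using eps_pos by simp
    ultimately have "0 \<le> \<epsilon> * (u x' + K * \<tau> * C) + G x p + 2 * C * K * \<delta>"
      by linarith
    then have "\<tau> * 0 \<le> \<tau> * (\<epsilon> * (u x' + K * \<tau> * C) + G x p + 2 * C * K * \<delta>)"
      using \<open>0 < \<tau>\<close> by (intro mult_left_mono) auto
    moreover have "u x' \<le> v y + (norm (y - x'))\<^sup>2 / (2 * \<delta>)"
      by (rule u_le)
    moreover have "(norm (y - x'))\<^sup>2 / (2 * \<delta>)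
        = (norm (y - x))\<^sup>2 / (2 * \<delta>) - \<tau> * (p \<bullet> w) + \<tau>\<^sup>2 * (norm w)\<^sup>2 / (2 * \<delta>)"
      using \<open>0 < \<delta>\<close> unfolding p_def \<pi>_def y_def x'_def power2_norm_eq_inner
      by (simp add: inner_simps inner_commute field_simps power2_eq_square)
    moreover have "\<tau>\<^sup>2 * (norm w)\<^sup>2 / (2 * \<delta>) \<le> \<tau>\<^sup>2 * C\<^sup>2 / (2 * \<delta>)"
      using w \<open>0 < \<delta>\<close> by (intro divide_right_mono mult_left_mono power_mono) auto
    ultimately have "u x' - \<tau> * (\<epsilon> * (u x' + K * \<tau> * C) + G x p + 2 * C * K * \<delta>)
        + \<tau> * (p \<bullet> w) - \<tau>\<^sup>2 * C\<^sup>2 / (2 * \<delta>) \<le> u x"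
      by (simp add: u_def[of x] y_def)
    moreover have "u x' - \<tau> * (\<epsilon> * (u x' + K * \<tau> * C) + G x p + 2 * C * K * \<delta>)
        + \<tau> * (p \<bullet> w) - \<tau>\<^sup>2 * C\<^sup>2 / (2 * \<delta>)
        = (1 - \<epsilon> * \<tau>) * u x' + \<tau> * (p \<bullet> w - G x p - e)"
      using \<open>0 < \<delta>\<close> by (simp add: e_def field_simps power2_eq_square)
    ultimately show ?thesis
      by (simp add: x'_def w_def p_def)
  qed
  have "\<forall>x. norm (\<pi> x) \<le> 2 * K \<and>
       (1 - \<epsilon> * \<tau>) * u (x - \<tau> *\<^sub>R Gp x (\<pi> x)) + \<tau> * (\<pi> x \<bullet> Gp x (\<pi> x) - G x (\<pi> x) - e) \<le> u x"
    using pi_le step by blast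
  with near show ?thesis
    by blast
qed

text \<open>Nodes and costates are numbered backwards in time, starting at \<open>x\<close>. The last conjunct compares
  the orbit \<open>X\<close> with the perturbed orbit \<open>X + \<eta>\<close>, whose velocities are \<open>Gp (X j) (P j) + \<omega> j\<close>.\<close>

definition near_optimal ::
    "'a \<Rightarrow> real \<Rightarrow> real \<Rightarrow> real \<Rightarrow> nat \<Rightarrow> (nat \<Rightarrow> 'a) \<Rightarrow> (nat \<Rightarrow> 'a) \<Rightarrow> bool" where
  "near_optimal x \<tau> A E N X P \<longleftrightarrow>
    X 0 = x \<and> (\<forall>j. X (Suc j) = X j - \<tau> *\<^sub>R Gp (X j) (P j)) \<and> (\<forall>j. norm (P j) \<le> R) \<and>
    (\<forall>\<omega> \<eta>. (\<forall>j. norm (\<omega> j) \<le> A) \<longrightarrow> (\<forall>j<N. \<eta> j = \<eta> (Suc j) + \<tau> *\<^sub>R \<omega> j) \<longrightarrow>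
       v (x + \<eta> 0) - v x \<le> (1 - \<epsilon> * \<tau>) ^ N * (v (X N + \<eta> N) - v (X N))
         + (\<Sum>j<N. \<tau> * (1 - \<epsilon> * \<tau>) ^ j * (P j \<bullet> \<omega> j - Gx (X j) (P j) \<bullet> \<eta> j
             + M * ((norm (\<omega> j))\<^sup>2 + (norm (\<eta> j))\<^sup>2)))
         + E * sqrt \<tau>)"

text \<open>The orbit follows the velocities selected by the inf-convolution; every perturbed orbit
  is estimated by the sup-convolution. Subtracting the two iterated inequalities leaves the
  expansion of the running cost. The constant \<open>E\<close> is chosen before \<open>N\<close> and
  \<tau>.\<close>

lemma near_optimal_exists:
  assumes "0 \<le> T" "0 \<le> A"
  shows "\<exists>E\<ge>0. \<forall>N \<tau>. 0 < \<tau> \<longrightarrow> \<tau> \<le> 1 \<longrightarrow> \<epsilon> * \<tau> \<le> 1 \<longrightarrow> real N * \<tau> \<le> T \<longrightarrow>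
    (\<exists>X P. near_optimal x \<tau> A E N X P)"
proof -
  define err where "err W = \<epsilon> * K * W + 2 * C * K + W\<^sup>2 / 2" for W
  \<comment> \<open>Bounds the perturbed velocities: \<open>Gp\<close> is at most \<open>C\<close>
    and the perturbation at most \<open>A\<close>.\<close>
  define W where "W = C + A"
  \<comment> \<open>The gap between \<open>v\<close> and a convolution is paid twice, both times at
    the last node; at the first node the orderings of \<open>u\<close>, \<open>v\<close> and
    \<open>u'\<close> already point the right way. The rest is the accumulated one-step error of the
    two iterations.\<close>
  define E where "E = 4 * K\<^sup>2 + T * (err W + err C)"
  have W: "0 \<le> W"
    using assms C_nonneg by (simp add: W_def)
  have err_nonneg: "0 \<le> err V" if "0 \<le> V" for V
    using that eps_pos K_nonneg C_nonneg by (simp add: err_def)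
  have "0 \<le> E"
    using err_nonneg W C_nonneg \<open>0 \<le> T\<close> by (simp add: E_def)
  moreover have "\<exists>X P. near_optimal x \<tau> A E N X P"
    if \<tau>: "0 < \<tau>" "\<tau> \<le> 1" "\<epsilon> * \<tau> \<le> 1" "real N * \<tau> \<le> T" for N :: nat and \<tau>
  proof -
    define \<kappa> where "\<kappa> = 1 - \<epsilon> * \<tau>"
    \<comment> \<open>This choice balances the error of order \<delta> against the one of order
      \<tau> / \<delta>.\<close>
    define \<delta> where "\<delta> = sqrt \<tau>"
    define e where "e V = \<epsilon> * K * \<tau> * V + 2 * C * K * \<delta> + \<tau> * V\<^sup>2 / (2 * \<delta>)" for V
    have \<kappa>: "0 \<le> \<kappa>" "\<kappa> \<le> 1"
      using \<tau> eps_pos by (auto simp: \<kappa>_def)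
    have \<delta>: "0 < \<delta>" "\<tau> = \<delta> * \<delta>"
      using \<tau> by (auto simp: \<delta>_def)
    have "\<delta> \<le> 1"
      using \<tau> by (simp add: \<delta>_def)
    have e_nonneg: "0 \<le> e V" if "0 \<le> V" for V
      using that eps_pos K_nonneg C_nonneg \<tau> \<delta>(1) by (simp add: e_def)
    have e_le: "e V \<le> err V * \<delta>" if "0 \<le> V" for V
    proof -
      have "(\<epsilon> * K * V) * (\<delta> * \<delta>) \<le> (\<epsilon> * K * V) * (1 * \<delta>)"
        using that eps_pos K_nonneg \<delta>(1) \<open>\<delta> \<le> 1\<close> by (intro mult_left_mono mult_right_mono) auto
      then show ?thesis
        using \<delta>(1) by (simp add: e_def err_def \<delta>(2) field_simps)
    qed
    have Ne_le: "real N * \<tau> * e V \<le> T * err V * \<delta>" if "0 \<le> V" for V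
    proof -
      have "real N * \<tau> * e V \<le> T * (err V * \<delta>)"
        using e_le[OF that] e_nonneg[OF that] \<tau> \<open>0 \<le> T\<close> by (intro mult_mono) auto
      then show ?thesis by simp
    qed
    obtain u where u: "\<And>y. v y \<le> u y" "\<And>y. u y \<le> v y + 2 * K\<^sup>2 * \<delta>"
      and ustep: "\<And>y w l. norm w \<le> W \<Longrightarrow> (\<And>p. norm p \<le> R \<Longrightarrow> p \<bullet> w - G y p \<le> l) \<Longrightarrow>
         u y \<le> \<kappa> * u (y - \<tau> *\<^sub>R w) + \<tau> * (l + e W)"
      using subsolution_step[OF \<delta>(1) \<tau>(1) W] unfolding e_def \<kappa>_def by metis
    obtain u' \<pi> where u': "\<And>y. v y - 2 * K\<^sup>2 * \<delta> \<le> u' y" "\<And>y. u' y \<le> v y"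
      and pi_le: "\<And>y. norm (\<pi> y) \<le> 2 * K"
      and ustep': "\<And>y. \<kappa> * u' (y - \<tau> *\<^sub>R Gp y (\<pi> y))
          + \<tau> * (\<pi> y \<bullet> Gp y (\<pi> y) - G y (\<pi> y) - e C) \<le> u' y"
      using supersolution_step[OF \<delta>(1) \<tau>(1)] unfolding e_def \<kappa>_def by metis
    define X where "X j = ((\<lambda>y. y - \<tau> *\<^sub>R Gp y (\<pi> y)) ^^ j) x" for j
    define P where "P j = \<pi> (X j)" for j
    define l where "l j = P j \<bullet> Gp (X j) (P j) - G (X j) (P j)" for j
    have X0: "X 0 = x" and XS: "X (Suc j) = X j - \<tau> *\<^sub>R Gp (X j) (P j)" for j
      by (simp_all add: X_def P_def)
    have PR: "norm (P j) \<le> R" for j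
      using pi_le[of "X j"] K_le_R by (simp add: P_def)
    \<comment> \<open>A change of sign turns the supersolution recursion into the form that
      \<open>discounted_iteration\<close> accepts.\<close>
    have "- u' (X j) \<le> \<kappa> * - u' (X (Suc j)) + \<tau> * (- l j + e C)" for j
      using ustep'[of "X j"] by (simp add: XS P_def l_def algebra_simps)
    then have "- u' (X 0) \<le> \<kappa> ^ N * - u' (X N) + (\<Sum>j<N. \<tau> * \<kappa> ^ j * - l j) + real N * \<tau> * e C"
      using \<kappa> \<tau> e_nonneg[OF C_nonneg]
      by (intro discounted_iteration[where a = "\<lambda>j. - u' (X j)"]) auto
    then have low: "\<kappa> ^ N * u' (X N) + (\<Sum>j<N. \<tau> * \<kappa> ^ j * l j) - T * err C * \<delta> \<le> v x"
      using Ne_le[OF C_nonneg] u'(2)[of x] by (simp add: X0 sum_negf)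
    have "v (x + \<eta> 0) - v x \<le> \<kappa> ^ N * (v (X N + \<eta> N) - v (X N))
         + (\<Sum>j<N. \<tau> * \<kappa> ^ j * (P j \<bullet> \<omega> j - Gx (X j) (P j) \<bullet> \<eta> j
             + M * ((norm (\<omega> j))\<^sup>2 + (norm (\<eta> j))\<^sup>2)))
         + E * \<delta>"
      if \<omega>: "\<And>j. norm (\<omega> j) \<le> A" and \<eta>: "\<And>j. j < N \<Longrightarrow> \<eta> j = \<eta> (Suc j) + \<tau> *\<^sub>R \<omega> j" for \<omega> \<eta>
    proof -
      define r where "r j = P j \<bullet> \<omega> j - Gx (X j) (P j) \<bullet> \<eta> j
             + M * ((norm (\<omega> j))\<^sup>2 + (norm (\<eta> j))\<^sup>2)" for j
      have "u (X j + \<eta> j) \<le> \<kappa> * u (X (Suc j) + \<eta> (Suc j)) + \<tau> * ((l j + r j) + e W)" if "j < N" for j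
      proof -
        have "norm (Gp (X j) (P j) + \<omega> j) \<le> W"
          using norm_triangle_le[OF add_mono[OF Gp_bounded[OF PR[of j], of "X j"] \<omega>[of j]]]
          by (simp add: W_def)
        moreover have "p \<bullet> (Gp (X j) (P j) + \<omega> j) - G (X j + \<eta> j) p \<le> l j + r j" if "norm p \<le> R" for p
          using lagrangian_expansion[OF PR[of j] that, where x = "X j" and \<omega> = "\<omega> j" and \<eta> = "\<eta> j" ]
          by (simp add: l_def r_def)
        ultimately have "u (X j + \<eta> j)
            \<le> \<kappa> * u (X j + \<eta> j - \<tau> *\<^sub>R (Gp (X j) (P j) + \<omega> j)) + \<tau> * ((l j + r j) + e W)"
          by (rule ustep)
        moreover have "X j + \<eta> j - \<tau> *\<^sub>R (Gp (X j) (P j) + \<omega> j) = X (Suc j) + \<eta> (Suc j)"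
          using \<eta>[OF \<open>j < N\<close>] by (simp add: XS algebra_simps)
        ultimately show ?thesis by simp
      qed
      then have "u (X 0 + \<eta> 0) \<le> \<kappa> ^ N * u (X N + \<eta> N) + (\<Sum>j<N. \<tau> * \<kappa> ^ j * (l j + r j)) + real N * \<tau> * e W"
        using \<kappa> \<tau> e_nonneg[OF W]
        by (intro discounted_iteration[where a = "\<lambda>j. u (X j + \<eta> j)"]) auto
      then have up: "v (x + \<eta> 0) \<le> \<kappa> ^ N * u (X N + \<eta> N)
          + ((\<Sum>j<N. \<tau> * \<kappa> ^ j * l j) + (\<Sum>j<N. \<tau> * \<kappa> ^ j * r j)) + T * err W * \<delta>"
        using Ne_le[OF W] u(1)[of "x + \<eta> 0"] by (simp add: X0 sum.distrib distrib_left)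
      have "\<kappa> ^ N * (u (X N + \<eta> N) - u' (X N)) \<le> \<kappa> ^ N * (v (X N + \<eta> N) - v (X N) + 4 * K\<^sup>2 * \<delta>)"
        using u(2)[of "X N + \<eta> N"] u'(1)[of "X N"] \<kappa> by (intro mult_left_mono) auto
      also have "\<dots> \<le> \<kappa> ^ N * (v (X N + \<eta> N) - v (X N)) + 1 * (4 * K\<^sup>2 * \<delta>)"
        using \<kappa> \<delta>(1) unfolding distrib_left
        by (intro add_left_mono mult_right_mono power_le_one) auto
      finally show ?thesis
        using up low unfolding r_def[symmetric] E_def by (simp add: algebra_simps)
    qed
    then have "near_optimal x \<tau> A E N X P"
      unfolding near_optimal_def using X0 XS PR by (simp add: \<kappa>_def \<delta>_def)
    then show ?thesis by blast
  qed
  ultimately show ?thesis by blast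
qed

lemma near_optimalD:
  assumes "near_optimal x \<tau> A E N X P"
  shows "X 0 = x" "X (Suc j) = X j - \<tau> *\<^sub>R Gp (X j) (P j)" "norm (P j) \<le> R"
    and "\<lbrakk>\<And>j. norm (\<omega> j) \<le> A; \<And>j. j < N \<Longrightarrow> \<eta> j = \<eta> (Suc j) + \<tau> *\<^sub>R \<omega> j\<rbrakk> \<Longrightarrow>
       v (x + \<eta> 0) - v x \<le> (1 - \<epsilon> * \<tau>) ^ N * (v (X N + \<eta> N) - v (X N))
         + (\<Sum>j<N. \<tau> * (1 - \<epsilon> * \<tau>) ^ j * (P j \<bullet> \<omega> j - Gx (X j) (P j) \<bullet> \<eta> j
             + M * ((norm (\<omega> j))\<^sup>2 + (norm (\<eta> j))\<^sup>2)))
         + E * sqrt \<tau>"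
  using assms by (auto simp: near_optimal_def)

lemma quadratic_remainder_le:
  assumes "0 \<le> \<tau>" "\<epsilon> * \<tau> \<le> 1" "real N * \<tau> \<le> T"
    and "\<And>j. j < N \<Longrightarrow> norm (\<omega> j) \<le> a" "\<And>j. j < N \<Longrightarrow> norm (\<eta> j) \<le> b" "0 \<le> a" "0 \<le> b"
  shows "(\<Sum>j<N. \<tau> * (1 - \<epsilon> * \<tau>) ^ j * (M * ((norm (\<omega> j))\<^sup>2 + (norm (\<eta> j))\<^sup>2)))
    \<le> T * M * (a\<^sup>2 + b\<^sup>2)"
proof -
  have "(\<Sum>j<N. \<tau> * (1 - \<epsilon> * \<tau>) ^ j * (M * ((norm (\<omega> j))\<^sup>2 + (norm (\<eta> j))\<^sup>2)))
      \<le> (\<Sum>j<N. \<tau> * 1 * (M * (a\<^sup>2 + b\<^sup>2)))"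
    using assms M_nonneg eps_pos
    by (intro sum_mono mult_mono power_le_one add_mono power_mono)
      (auto intro!: mult_nonneg_nonneg)
  also have "\<dots> = (real N * \<tau>) * (M * (a\<^sup>2 + b\<^sup>2))"
    by simp
  also have "\<dots> \<le> T * (M * (a\<^sup>2 + b\<^sup>2))"
    using assms M_nonneg by (intro mult_right_mono) auto
  finally show ?thesis by simp
qed

text \<open>The two perturbations starting at h and -h have opposite linear parts, which cancel in
  the sum. Over a unit horizon both the velocity perturbation and the displacements are at most the
  norm of h, so each sign contributes \<open>2 * M\<close> times its square; the remaining error
  vanishes with \<tau>.\<close>

lemma semiconcave: "v (z + h) + v (z - h) - 2 * v z \<le> 4 * M * (norm h)\<^sup>2"
proof -
  obtain E where "0 \<le> E" and E: "\<And>N \<tau>. 0 < \<tau> \<Longrightarrow> \<tau> \<le> 1 \<Longrightarrow> \<epsilon> * \<tau> \<le> 1 \<Longrightarrow> real N * \<tau> \<le> 1 \<Longrightarrow>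
      \<exists>X P. near_optimal z \<tau> (norm h) E N X P"
    using near_optimal_exists[of 1 "norm h" z] by auto
  have "\<forall>\<^sub>F N in sequentially. \<epsilon> / real N < 1"
    by (intro order_tendstoD[OF lim_const_over_n]) auto
  then have "\<forall>\<^sub>F N in sequentially. v (z + h) + v (z - h) - 2 * v z
      \<le> 4 * M * (norm h)\<^sup>2 + 2 * E * sqrt (1 / real N)"
    using eventually_gt_at_top[of 0]
  proof eventually_elim
    case (elim N)
    define \<tau> where "\<tau> = 1 / real N"
    have \<tau>: "0 < \<tau>" "\<tau> \<le> 1" "\<epsilon> * \<tau> \<le> 1" "real N * \<tau> \<le> 1" "real N * \<tau> = 1"
      using elim by (auto simp: \<tau>_def)
    obtain X P where XP: "near_optimal z \<tau> (norm h) E N X P"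
      using E[OF \<tau>(1-4)] by blast
    \<comment> \<open>The displacement fades linearly from \<open>k\<close> to 0, so the unknown
      increment of \<open>v\<close> at the last node drops out.\<close>
    define \<eta> where "\<eta> k j = (1 - real j * \<tau>) *\<^sub>R k" for k :: 'a and j
    have \<eta>: "\<eta> k 0 = k" "\<eta> k N = 0" "\<eta> k j = \<eta> k (Suc j) + \<tau> *\<^sub>R k" for k j
      using \<tau>(5) by (simp_all add: \<eta>_def algebra_simps flip: scaleR_left_distrib)
    have \<eta>_le: "norm (\<eta> k j) \<le> norm k" if "j < N" for k j
    proof -
      have "real j * \<tau> \<le> real N * \<tau>"
        using that \<tau> by (intro mult_right_mono) auto
      then have "\<bar>1 - real j * \<tau>\<bar> \<le> 1"
        using \<tau> by simp
      then show ?thesis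
        by (simp add: \<eta>_def mult_left_le_one_le)
    qed
    define lin where "lin k = (\<Sum>j<N. \<tau> * (1 - \<epsilon> * \<tau>) ^ j * (P j \<bullet> k - Gx (X j) (P j) \<bullet> \<eta> k j))" for k
    have var: "v (z + k) - v z \<le> lin k + 2 * M * (norm h)\<^sup>2 + E * sqrt \<tau>"
      if k: "norm k = norm h" for k
    proof -
      have "v (z + \<eta> k 0) - v z \<le> (1 - \<epsilon> * \<tau>) ^ N * (v (X N + \<eta> k N) - v (X N))
         + (\<Sum>j<N. \<tau> * (1 - \<epsilon> * \<tau>) ^ j * (P j \<bullet> k - Gx (X j) (P j) \<bullet> \<eta> k j
             + M * ((norm k)\<^sup>2 + (norm (\<eta> k j))\<^sup>2)))
         + E * sqrt \<tau>"
        by (rule near_optimalD(4)[OF XP, of "\<lambda>_. k" "\<eta> k"]) (use k in simp, rule \<eta>(3))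
      moreover have "(\<Sum>j<N. \<tau> * (1 - \<epsilon> * \<tau>) ^ j * (M * ((norm k)\<^sup>2 + (norm (\<eta> k j))\<^sup>2)))
          \<le> 1 * M * ((norm k)\<^sup>2 + (norm k)\<^sup>2)"
        by (rule quadratic_remainder_le) (use \<tau> \<eta>_le in auto)
      ultimately show ?thesis
        unfolding distrib_left[of "_ * _ ^ _" "_ - _"] sum.distrib lin_def[symmetric]
        by (simp add: \<eta>(1,2) k)
    qed
    have "lin (- h) = - lin h"
      by (simp add: lin_def \<eta>_def algebra_simps flip: sum_negf)
    then show ?case
      using var[of h] var[of "- h"] by (simp add: \<tau>_def)
  qed
  moreover have "(\<lambda>N. 4 * M * (norm h)\<^sup>2 + 2 * E * sqrt (1 / real N)) \<longlonglongrightarrow> 4 * M * (norm h)\<^sup>2 + 2 * E * sqrt 0"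
    by (intro tendsto_intros lim_const_over_n)
  ultimately show ?thesis
    using tendsto_lowerbound[of _ "4 * M * (norm h)\<^sup>2 + 2 * E * sqrt 0"] by fastforce
qed

section \<open>Convergence of the orbits to characteristics\<close>

text \<open>Integrating-factor form of the adjoint equation: the weight (1 - \<epsilon> \<tau>)^j is
  the discrete exp(- \<epsilon> t), and the discounted costate changes exactly by the accumulated
  discounted force.\<close>

definition impulse :: "real \<Rightarrow> (nat \<Rightarrow> 'a) \<Rightarrow> (nat \<Rightarrow> 'a) \<Rightarrow> nat \<Rightarrow> 'a" where
  "impulse \<tau> X P i = (\<Sum>j<i. (\<tau> * (1 - \<epsilon> * \<tau>) ^ j) *\<^sub>R Gx (X j) (P j))"

text \<open>Measures how far the costate \<open>P\<close> is from satisfying a discretisation of the equation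
  \<open>p' = - Gx - \<epsilon> p\<close> (with time reversed) and the terminal condition \<open>p = D\<close>.\<close>

definition defect :: "'a \<Rightarrow> real \<Rightarrow> (nat \<Rightarrow> 'a) \<Rightarrow> (nat \<Rightarrow> 'a) \<Rightarrow> nat \<Rightarrow> 'a" where
  "defect D \<tau> X P i = (1 - \<epsilon> * \<tau>) ^ i *\<^sub>R P i - impulse \<tau> X P (Suc i) - D"

text \<open>Summation by parts exhibits the defect as the gradient of the linear part with respect
  to \<omega>. The vector \<open>D\<close> is arbitrary here: it is inserted by telescoping the
  pairing of \<open>D\<close> with the displacements, and is later taken to be the gradient of
  \<open>v\<close> at the start.\<close>

lemma first_variation_eq:
  assumes "\<And>j. j < N \<Longrightarrow> \<eta> j = \<eta> (Suc j) + \<tau> *\<^sub>R \<omega> j"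
  shows "(\<Sum>j<N. \<tau> * (1 - \<epsilon> * \<tau>) ^ j * (P j \<bullet> \<omega> j - Gx (X j) (P j) \<bullet> \<eta> j))
    = D \<bullet> \<eta> 0 - (D + impulse \<tau> X P N) \<bullet> \<eta> N + (\<Sum>i<N. \<tau> * (\<omega> i \<bullet> defect D \<tau> X P i))"
proof -
  have "(\<Sum>j<N. \<tau> * (1 - \<epsilon> * \<tau>) ^ j * (Gx (X j) (P j) \<bullet> \<eta> j))
      = (\<Sum>j<N. ((\<tau> * (1 - \<epsilon> * \<tau>) ^ j) *\<^sub>R Gx (X j) (P j)) \<bullet> \<eta> j)"
    by simp
  also have "\<dots> = impulse \<tau> X P N \<bullet> \<eta> N + (\<Sum>i<N. \<tau> * (\<omega> i \<bullet> impulse \<tau> X P (Suc i)))"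
    unfolding impulse_def using assms by (rule abel_summation)
  finally have 1: "(\<Sum>j<N. \<tau> * (1 - \<epsilon> * \<tau>) ^ j * (Gx (X j) (P j) \<bullet> \<eta> j))
      = impulse \<tau> X P N \<bullet> \<eta> N + (\<Sum>i<N. \<tau> * (\<omega> i \<bullet> impulse \<tau> X P (Suc i)))" .
  have "D \<bullet> \<eta> 0 - D \<bullet> \<eta> N = (\<Sum>i<N. D \<bullet> \<eta> i - D \<bullet> \<eta> (Suc i))"
    by (rule sum_lessThan_telescope'[symmetric])
  also have "\<dots> = (\<Sum>i<N. \<tau> * (\<omega> i \<bullet> D))"
    using assms by (intro sum.cong) (auto simp: inner_simps inner_commute)
  finally have 2: "D \<bullet> \<eta> 0 = D \<bullet> \<eta> N + (\<Sum>i<N. \<tau> * (\<omega> i \<bullet> D))"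
    by simp
  show ?thesis
    using 1 2
    by (simp add: defect_def inner_simps right_diff_distrib sum_subtractf inner_commute mult_ac)
qed

lemma norm_impulse_le:
  assumes "0 \<le> \<tau>" "\<epsilon> * \<tau> \<le> 1" "real N * \<tau> \<le> T" "i \<le> N" "\<And>j. norm (P j) \<le> R"
  shows "norm (impulse \<tau> X P i) \<le> T * C"
  unfolding impulse_def using assms eps_pos C_nonneg
  by (intro sum_norm_le_scaled[where N = N and \<tau> = \<tau>])
    (auto intro!: Gx_bounded mult_left_le power_le_one simp: abs_mult)

lemma norm_defect_le:
  assumes "0 \<le> \<tau>" "\<epsilon> * \<tau> \<le> 1" "real N * \<tau> \<le> T" "i < N" "\<And>j. norm (P j) \<le> R"
  shows "norm (defect D \<tau> X P i) \<le> R + T * C + norm D"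
proof -
  have "norm ((1 - \<epsilon> * \<tau>) ^ i *\<^sub>R P i) \<le> 1 * R"
    unfolding norm_scaleR using assms eps_pos
    by (intro mult_mono) (auto intro: power_le_one)
  moreover have "norm (impulse \<tau> X P (Suc i)) \<le> T * C"
    using assms by (intro norm_impulse_le[where N = N]) auto
  ultimately show ?thesis
    unfolding defect_def by (smt (verit) norm_triangle_ineq4)
qed

text \<open>The velocities are perturbed against the defect itself, so the linear part becomes -r
  times its squared norm, while \<open>sub\<close>, the lower half of differentiability at scale
  \<open>T * (r * B)\<close>, forbids \<open>v\<close> to drop below its linearisation by more than
  the error. After division by r the quadratic terms are O(r) and the last term is
  O(\<open>sqrt \<tau>\<close> / r).\<close>

lemma defect_variation:
  assumes near: "near_optimal x \<tau> A E N X P"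
    and \<tau>: "0 < \<tau>" "\<epsilon> * \<tau> \<le> 1" "real N * \<tau> \<le> T"
    and B: "B = R + T * C + norm D" "B \<le> A" and r: "0 \<le> r" "r \<le> 1"
    and sub: "\<And>k. norm k \<le> T * (r * B) \<Longrightarrow> D \<bullet> k - e * norm k \<le> v (x + k) - v x" and "0 \<le> e"
  shows "r * (\<Sum>i<N. \<tau> * (norm (defect D \<tau> X P i))\<^sup>2)
    \<le> e * (T * (r * B)) + T * M * ((r * B)\<^sup>2 + (T * (r * B))\<^sup>2) + E * sqrt \<tau>"
proof -
  note nd = near_optimalD[OF near]
  have "0 \<le> real N * \<tau>"
    using \<tau> by simp
  then have "0 \<le> T"
    using \<tau> by linarith
  then have "0 \<le> B"
    using B K_nonneg K_le_R C_nonneg by simp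
  let ?Z = "defect D \<tau> X P"
  \<comment> \<open>The defect is bounded only for indices below \<open>N\<close>, but the amplitude
    bound in \<open>near_optimal\<close> concerns every index; hence the value 0 from
    \<open>N\<close> on.\<close>
  define \<omega> where "\<omega> j = (if j < N then - (r *\<^sub>R ?Z j) else 0)" for j
  define \<eta> where "\<eta> j = (\<Sum>i\<in>{j..<N}. \<tau> *\<^sub>R \<omega> i)" for j
  have \<omega>_le: "norm (\<omega> j) \<le> r * B" for j
    using norm_defect_le[of \<tau> N T j P D X] \<tau> nd(3) r \<open>0 \<le> B\<close>
    by (auto simp: \<omega>_def B intro!: mult_left_mono)
  have \<omega>_A: "norm (\<omega> j) \<le> A" for j
  proof -
    have "r * B \<le> 1 * B"
      using r \<open>0 \<le> B\<close> by (intro mult_right_mono) auto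
    then show ?thesis
      using \<omega>_le[of j] B by simp
  qed
  have \<eta>_step: "\<eta> j = \<eta> (Suc j) + \<tau> *\<^sub>R \<omega> j" if "j < N" for j
    using that by (simp add: \<eta>_def sum.atLeast_Suc_lessThan)
  have \<eta>_le: "norm (\<eta> j) \<le> T * (r * B)" for j
  proof -
    have "norm (\<eta> j) \<le> (\<Sum>i\<in>{j..<N}. \<tau> * (r * B))"
      unfolding \<eta>_def using \<omega>_le \<tau> by (intro sum_norm_le) auto
    also have "\<dots> \<le> (\<Sum>i<N. \<tau> * (r * B))"
      using \<tau> r \<open>0 \<le> B\<close> by (intro sum_mono2) auto
    also have "\<dots> = (real N * \<tau>) * (r * B)"
      by simp
    also have "\<dots> \<le> T * (r * B)"
      using \<tau> r \<open>0 \<le> B\<close> by (intro mult_right_mono) auto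
    finally show ?thesis .
  qed
  have "\<eta> N = 0"
    by (simp add: \<eta>_def)
  have "v (x + \<eta> 0) - v x \<le> (\<Sum>j<N. \<tau> * (1 - \<epsilon> * \<tau>) ^ j * (P j \<bullet> \<omega> j - Gx (X j) (P j) \<bullet> \<eta> j
             + M * ((norm (\<omega> j))\<^sup>2 + (norm (\<eta> j))\<^sup>2))) + E * sqrt \<tau>"
    using nd(4)[of \<omega> \<eta>, OF \<omega>_A \<eta>_step] \<open>\<eta> N = 0\<close> by simp
  also have "\<dots> = (\<Sum>j<N. \<tau> * (1 - \<epsilon> * \<tau>) ^ j * (P j \<bullet> \<omega> j - Gx (X j) (P j) \<bullet> \<eta> j))
      + (\<Sum>j<N. \<tau> * (1 - \<epsilon> * \<tau>) ^ j * (M * ((norm (\<omega> j))\<^sup>2 + (norm (\<eta> j))\<^sup>2))) + E * sqrt \<tau>"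
    unfolding distrib_left[of "_ * _ ^ _" "_ - _"] sum.distrib by simp
  also have "(\<Sum>j<N. \<tau> * (1 - \<epsilon> * \<tau>) ^ j * (P j \<bullet> \<omega> j - Gx (X j) (P j) \<bullet> \<eta> j))
      = D \<bullet> \<eta> 0 + (\<Sum>i<N. \<tau> * (\<omega> i \<bullet> ?Z i))"
    using first_variation_eq[of N \<eta> \<tau> \<omega> P X D, OF \<eta>_step] \<open>\<eta> N = 0\<close> by simp
  also have "(\<Sum>i<N. \<tau> * (\<omega> i \<bullet> ?Z i)) = - (r * (\<Sum>i<N. \<tau> * (norm (?Z i))\<^sup>2))"
    by (simp add: \<omega>_def power2_norm_eq_inner sum_distrib_left mult_ac flip: sum_negf)
  also have "(\<Sum>j<N. \<tau> * (1 - \<epsilon> * \<tau>) ^ j * (M * ((norm (\<omega> j))\<^sup>2 + (norm (\<eta> j))\<^sup>2)))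
      \<le> T * M * ((r * B)\<^sup>2 + (T * (r * B))\<^sup>2)"
    using \<tau> \<omega>_le \<eta>_le r \<open>0 \<le> B\<close> \<open>0 \<le> T\<close> by (intro quadratic_remainder_le) auto
  finally have "v (x + \<eta> 0) - v x \<le> D \<bullet> \<eta> 0 - r * (\<Sum>i<N. \<tau> * (norm (?Z i))\<^sup>2)
      + T * M * ((r * B)\<^sup>2 + (T * (r * B))\<^sup>2) + E * sqrt \<tau>"
    by linarith
  moreover have "D \<bullet> \<eta> 0 - e * norm (\<eta> 0) \<le> v (x + \<eta> 0) - v x"
    using \<eta>_le by (rule sub)
  moreover have "e * norm (\<eta> 0) \<le> e * (T * (r * B))"
    using \<eta>_le \<open>0 \<le> e\<close> by (intro mult_left_mono)
  ultimately show ?thesis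
    by linarith
qed

section \<open>Stability of the discretised characteristic system\<close>

text \<open>Here \<xi> and \<rho> are sequences, later samples of the characteristic at multiples of
  \<tau>. The costates \<open>P\<close> are not evolved by a scheme: each is recovered from the
  momentum balance up to its defect, after division by a discount factor that stays above
  \<open>k0\<close>. Position and momentum errors at a node are thus controlled by the errors at
  earlier nodes, and Gronwall closes the loop.\<close>

lemma orbit_near_characteristic:
  assumes orbit: "X 0 = \<xi> 0" "\<And>j. X (Suc j) = X j - \<tau> *\<^sub>R Gp (X j) (P j)" "\<And>j. norm (P j) \<le> R"
    and \<rho>: "\<And>j. j \<le> N \<Longrightarrow> norm (\<rho> j) \<le> R"
    and cons_x: "\<And>j. j < N \<Longrightarrow> norm (\<xi> (Suc j) - \<xi> j + \<tau> *\<^sub>R Gp (\<xi> j) (\<rho> j)) \<le> B * \<tau>\<^sup>2"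
    and cons_p: "\<And>j. j < N \<Longrightarrow>
      norm ((1 - \<epsilon> * \<tau>) *\<^sub>R \<rho> (Suc j) - \<rho> j - \<tau> *\<^sub>R Gx (\<xi> j) (\<rho> j)) \<le> B * \<tau>\<^sup>2"
    and \<tau>: "0 < \<tau>" "\<epsilon> * \<tau> \<le> 1" "real N * \<tau> = T"
    and k0: "0 < k0" "k0 \<le> (1 - \<epsilon> * \<tau>) ^ N" and B: "0 \<le> B"
  defines "\<Theta> \<equiv> \<Sum>i<N. \<tau> * norm (defect (\<rho> 0) \<tau> X P i)"
  defines "Q \<equiv> exp ((C + C / k0) * T) * (\<Theta> / k0 + T * (T * B + (C + T * B) / k0) * \<tau>)"
  shows "norm (X N - \<xi> N) \<le> C * Q + T * B * \<tau>"
    and "norm (\<rho> 0 + impulse \<tau> X P N - (1 - \<epsilon> * \<tau>) ^ N *\<^sub>R \<rho> N) \<le> C * Q + T * B * \<tau>"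
proof -
  define \<kappa> where "\<kappa> = 1 - \<epsilon> * \<tau>"
  have \<kappa>: "0 \<le> \<kappa>" "\<kappa> \<le> 1"
    using \<tau> eps_pos by (auto simp: \<kappa>_def)
  have \<kappa>_pow: "\<kappa> ^ j \<le> 1" "0 \<le> \<kappa> ^ j" for j
    using \<kappa> by (auto intro: power_le_one)
  have \<kappa>_ge: "k0 \<le> \<kappa> ^ j" if "j \<le> N" for j
    using power_decreasing[OF that \<kappa>] k0 by (simp add: \<kappa>_def)
  have "0 \<le> T"
    using \<tau> by (metis less_imp_le mult_nonneg_nonneg of_nat_0_le_iff)
  define \<Delta> where "\<Delta> j = norm (X j - \<xi> j) + norm (P j - \<rho> j)" for j
  define S where "S i = \<tau> * (\<Sum>j<i. \<Delta> j)" for i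
  have steps_le: "real i * (B * \<tau>\<^sup>2) \<le> T * B * \<tau>" if "i \<le> N" for i
  proof -
    have "real i * (B * \<tau>\<^sup>2) \<le> real N * (B * \<tau>\<^sup>2)"
      using that B by (intro mult_right_mono) auto
    also have "\<dots> = T * B * \<tau>"
      by (simp add: \<tau>(3)[symmetric] power2_eq_square)
    finally show ?thesis .
  qed
  have x_le: "norm (X i - \<xi> i) \<le> C * S i + T * B * \<tau>" if "i \<le> N" for i
  proof -
    let ?b = "\<lambda>j. - (\<tau> *\<^sub>R (Gp (X j) (P j) - Gp (\<xi> j) (\<rho> j)))"
    have "norm (X i - \<xi> i - (X 0 - \<xi> 0) - (\<Sum>j<i. ?b j)) \<le> real i * (B * \<tau>\<^sup>2)"
    proof (rule norm_sum_telescope_le)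
      fix j assume "j < i"
      have "X (Suc j) - \<xi> (Suc j) - (X j - \<xi> j) - ?b j = - (\<xi> (Suc j) - \<xi> j + \<tau> *\<^sub>R Gp (\<xi> j) (\<rho> j))"
        by (simp add: orbit(2) algebra_simps)
      then show "norm (X (Suc j) - \<xi> (Suc j) - (X j - \<xi> j) - ?b j) \<le> B * \<tau>\<^sup>2"
        using cons_x[of j] \<open>j < i\<close> that by (simp only: norm_minus_cancel)
    qed
    moreover have "norm (\<Sum>j<i. ?b j) \<le> (\<Sum>j<i. \<tau> * (C * \<Delta> j))"
      using Gp_lipschitz[OF orbit(3) \<rho>] \<tau> that
      by (intro sum_norm_le) (auto simp: \<Delta>_def intro!: mult_left_mono)
    moreover have "(\<Sum>j<i. \<tau> * (C * \<Delta> j)) = C * S i"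
      by (simp add: S_def sum_distrib_left mult_ac)
    moreover have "norm (X i - \<xi> i) \<le> norm (\<Sum>j<i. ?b j) + norm (X i - \<xi> i - (\<Sum>j<i. ?b j))"
      by (rule norm_triangle_sub)
    ultimately show ?thesis
      using steps_le[OF that] by (simp add: orbit(1))
  qed
  have p_le: "norm (\<rho> 0 + impulse \<tau> X P i - \<kappa> ^ i *\<^sub>R \<rho> i) \<le> C * S i + T * B * \<tau>" if "i \<le> N" for i
  proof -
    have "norm (\<kappa> ^ i *\<^sub>R \<rho> i - \<kappa> ^ 0 *\<^sub>R \<rho> 0 - (\<Sum>j<i. (\<tau> * \<kappa> ^ j) *\<^sub>R Gx (\<xi> j) (\<rho> j)))
        \<le> real i * (B * \<tau>\<^sup>2)"
    proof (rule norm_sum_telescope_le)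
      fix j assume "j < i"
      have "\<kappa> ^ Suc j *\<^sub>R \<rho> (Suc j) - \<kappa> ^ j *\<^sub>R \<rho> j - (\<tau> * \<kappa> ^ j) *\<^sub>R Gx (\<xi> j) (\<rho> j)
          = \<kappa> ^ j *\<^sub>R (\<kappa> *\<^sub>R \<rho> (Suc j) - \<rho> j - \<tau> *\<^sub>R Gx (\<xi> j) (\<rho> j))"
        by (simp add: algebra_simps)
      also have "norm \<dots> \<le> 1 * (B * \<tau>\<^sup>2)"
        unfolding norm_scaleR using cons_p[of j] \<open>j < i\<close> that \<kappa>_pow[of j]
        by (intro mult_mono) (auto simp: \<kappa>_def)
      finally show "norm (\<kappa> ^ Suc j *\<^sub>R \<rho> (Suc j) - \<kappa> ^ j *\<^sub>R \<rho> j
          - (\<tau> * \<kappa> ^ j) *\<^sub>R Gx (\<xi> j) (\<rho> j)) \<le> B * \<tau>\<^sup>2"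
        by simp
    qed
    then have 1: "norm (\<kappa> ^ i *\<^sub>R \<rho> i - \<rho> 0 - impulse \<tau> \<xi> \<rho> i) \<le> T * B * \<tau>"
      using steps_le[OF that] by (simp add: impulse_def \<kappa>_def)
    have "impulse \<tau> X P i - impulse \<tau> \<xi> \<rho> i
        = (\<Sum>j<i. (\<tau> * \<kappa> ^ j) *\<^sub>R (Gx (X j) (P j) - Gx (\<xi> j) (\<rho> j)))"
      by (simp add: impulse_def \<kappa>_def scaleR_diff_right sum_subtractf)
    also have "norm \<dots> \<le> (\<Sum>j<i. (\<tau> * 1) * (C * \<Delta> j))"
    proof (intro sum_norm_le)
      fix j assume "j \<in> {..<i}"
      then show "norm ((\<tau> * \<kappa> ^ j) *\<^sub>R (Gx (X j) (P j) - Gx (\<xi> j) (\<rho> j))) \<le> (\<tau> * 1) * (C * \<Delta> j)"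
        unfolding norm_scaleR using Gx_lipschitz[OF orbit(3)[of j] \<rho>[of j], of "X j" "\<xi> j"] \<tau> that \<kappa>_pow[of j]
        by (intro mult_mono) (auto simp: \<Delta>_def abs_mult)
    qed
    also have "\<dots> = C * S i"
      by (simp add: S_def sum_distrib_left mult_ac)
    finally have 2: "norm (impulse \<tau> X P i - impulse \<tau> \<xi> \<rho> i) \<le> C * S i" .
    have "\<rho> 0 + impulse \<tau> X P i - \<kappa> ^ i *\<^sub>R \<rho> i
        = (impulse \<tau> X P i - impulse \<tau> \<xi> \<rho> i) - (\<kappa> ^ i *\<^sub>R \<rho> i - \<rho> 0 - impulse \<tau> \<xi> \<rho> i)"
      by simp
    then show ?thesis
      using 1 2 norm_triangle_ineq4 by (smt (verit, best))
  qed
  have "\<Delta> i \<le> (C + C / k0) * (\<tau> * (\<Sum>j<i. \<Delta> j))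
      + (norm (defect (\<rho> 0) \<tau> X P i) / k0 + (T * B + (C + T * B) / k0) * \<tau>)" if "i < N" for i
  proof -
    \<comment> \<open>The defect at i uses the impulse up to and including i, whereas
      \<open>p_le\<close> compares impulses strictly before i. The last summand corrects this shift
      and costs only \<open>\<tau> * C\<close>.\<close>
    have "\<kappa> ^ i *\<^sub>R (P i - \<rho> i) = defect (\<rho> 0) \<tau> X P i
        + (\<rho> 0 + impulse \<tau> X P i - \<kappa> ^ i *\<^sub>R \<rho> i) + (\<tau> * \<kappa> ^ i) *\<^sub>R Gx (X i) (P i)"
      by (simp add: defect_def impulse_def \<kappa>_def algebra_simps)
    also have "norm \<dots> \<le> norm (defect (\<rho> 0) \<tau> X P i) + (C * S i + T * B * \<tau>) + \<tau> * C"
    proof (intro norm_triangle_mono order_refl p_le)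
      have "norm ((\<tau> * \<kappa> ^ i) *\<^sub>R Gx (X i) (P i)) \<le> (\<tau> * 1) * C"
        unfolding norm_scaleR using Gx_bounded[OF orbit(3)[of i], of "X i"] \<tau> \<kappa>_pow[of i]
        by (intro mult_mono) (auto simp: abs_mult)
      then show "norm ((\<tau> * \<kappa> ^ i) *\<^sub>R Gx (X i) (P i)) \<le> \<tau> * C"
        by simp
    qed (use that in simp)
    finally have "\<kappa> ^ i * norm (P i - \<rho> i)
        \<le> norm (defect (\<rho> 0) \<tau> X P i) + (C * S i + T * B * \<tau>) + \<tau> * C"
      using \<kappa>_pow[of i] by simp
    moreover have "k0 * norm (P i - \<rho> i) \<le> \<kappa> ^ i * norm (P i - \<rho> i)"
      using \<kappa>_ge[of i] that by (intro mult_right_mono) auto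
    ultimately have "norm (P i - \<rho> i)
        \<le> (norm (defect (\<rho> 0) \<tau> X P i) + (C * S i + T * B * \<tau>) + \<tau> * C) / k0"
      using k0(1) by (simp add: pos_le_divide_eq mult.commute)
    then show ?thesis
      using x_le[of i] that k0(1) unfolding \<Delta>_def[of i] S_def[symmetric]
      by (simp add: algebra_simps add_divide_distrib)
  qed
  then have "S N \<le> exp ((C + C / k0) * (real N * \<tau>)) * (\<tau> * (\<Sum>i<N.
      norm (defect (\<rho> 0) \<tau> X P i) / k0 + (T * B + (C + T * B) / k0) * \<tau>))"
    unfolding S_def using k0 C_nonneg \<tau> B \<open>0 \<le> T\<close>
    by (intro discrete_gronwall) auto
  also have "\<tau> * (\<Sum>i<N. norm (defect (\<rho> 0) \<tau> X P i) / k0 + (T * B + (C + T * B) / k0) * \<tau>)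
      = \<Theta> / k0 + T * (T * B + (C + T * B) / k0) * \<tau>"
    unfolding sum.distrib \<Theta>_def \<tau>(3)[symmetric]
    by (simp add: sum_distrib_left sum_divide_distrib distrib_left mult_ac)
  finally have "C * S N \<le> C * Q"
    using C_nonneg unfolding Q_def \<tau>(3) by (intro mult_left_mono)
  then show "norm (X N - \<xi> N) \<le> C * Q + T * B * \<tau>"
    and "norm (\<rho> 0 + impulse \<tau> X P N - (1 - \<epsilon> * \<tau>) ^ N *\<^sub>R \<rho> N) \<le> C * Q + T * B * \<tau>"
    using x_le[of N] p_le[of N] by (auto simp: \<kappa>_def)
qed

text \<open>Local truncation error of an Euler scheme. The damping multiplies the new costate,
  because then weighting step j by (1 - \<epsilon> \<tau>)^j makes the discounted costates
  telescope.\<close>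

lemma characteristic_consistency:
  assumes \<xi>: "\<And>t. t \<in> {0..T} \<Longrightarrow> (\<xi> has_vector_derivative - Gp (\<xi> t) (\<rho> t)) (at t within {0..T})"
    and \<rho>: "\<And>t. t \<in> {0..T} \<Longrightarrow> (\<rho> has_vector_derivative Gx (\<xi> t) (\<rho> t) + \<epsilon> *\<^sub>R \<rho> t) (at t within {0..T})"
    and \<rho>_le: "\<And>t. t \<in> {0..T} \<Longrightarrow> norm (\<rho> t) \<le> R"
  shows "\<exists>B\<ge>0. \<forall>t \<tau>. 0 \<le> t \<longrightarrow> 0 \<le> \<tau> \<longrightarrow> t + \<tau> \<le> T \<longrightarrow>
    norm (\<xi> (t + \<tau>) - \<xi> t + \<tau> *\<^sub>R Gp (\<xi> t) (\<rho> t)) \<le> B * \<tau>\<^sup>2 \<and>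
    norm ((1 - \<epsilon> * \<tau>) *\<^sub>R \<rho> (t + \<tau>) - \<rho> t - \<tau> *\<^sub>R Gx (\<xi> t) (\<rho> t)) \<le> B * \<tau>\<^sup>2"
proof -
  define L where "L = C + \<epsilon> * R"
  \<comment> \<open>\<open>C\<close> and \<open>L\<close> bound the speeds of \<xi> and \<rho>, so
    \<open>C * (C + L)\<close> bounds the rate at which \<open>Gp\<close> and \<open>Gx\<close>
    change along the curve. One \<open>\<epsilon> * L\<close> comes from the damping term of the
    equation, the other from evaluating it at the new time.\<close>
  define B where "B = (C * (C + L) + \<epsilon> * L) + \<epsilon> * L"
  have "0 \<le> R"
    using K_nonneg K_le_R by simp
  then have L: "0 \<le> L"
    using C_nonneg eps_pos by (simp add: L_def)
  have "0 \<le> B"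
    using L C_nonneg eps_pos by (simp add: B_def)
  moreover have "norm (\<xi> (t + \<tau>) - \<xi> t + \<tau> *\<^sub>R Gp (\<xi> t) (\<rho> t)) \<le> B * \<tau>\<^sup>2 \<and>
      norm ((1 - \<epsilon> * \<tau>) *\<^sub>R \<rho> (t + \<tau>) - \<rho> t - \<tau> *\<^sub>R Gx (\<xi> t) (\<rho> t)) \<le> B * \<tau>\<^sup>2"
    if t: "0 \<le> t" "0 \<le> \<tau>" "t + \<tau> \<le> T" for t \<tau>
  proof -
    have der_\<xi>: "(\<xi> has_vector_derivative - Gp (\<xi> s) (\<rho> s)) (at s within {t..r})"
      and der_\<rho>: "(\<rho> has_vector_derivative Gx (\<xi> s) (\<rho> s) + \<epsilon> *\<^sub>R \<rho> s) (at s within {t..r})"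
      if "s \<in> {t..r}" "r \<le> t + \<tau>" for s r
      using that t by (auto intro!: has_vector_derivative_within_subset[OF \<xi>]
          has_vector_derivative_within_subset[OF \<rho>])
    have \<rho>'_le: "norm (Gx (\<xi> s) (\<rho> s) + \<epsilon> *\<^sub>R \<rho> s) \<le> L" if "s \<in> {t..t + \<tau>}" for s
      using that t \<rho>_le[of s] Gx_bounded[of "\<rho> s" "\<xi> s"] eps_pos unfolding L_def
      by (intro norm_triangle_mono) auto
    have inc_\<xi>: "norm (\<xi> s - \<xi> t) \<le> C * \<tau>" if "s \<in> {t..t + \<tau>}" for s
    proof -
      have "norm (\<xi> s - \<xi> t) \<le> C * (s - t)"
        using that t \<rho>_le Gp_bounded
        by (intro vector_derivative_increment_le[OF _ der_\<xi>]) auto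
      also have "\<dots> \<le> C * \<tau>"
        using that C_nonneg by (intro mult_left_mono) auto
      finally show ?thesis .
    qed
    have inc_\<rho>: "norm (\<rho> s - \<rho> t) \<le> L * \<tau>" if "s \<in> {t..t + \<tau>}" for s
    proof -
      have "norm (\<rho> s - \<rho> t) \<le> L * (s - t)"
        using that t \<rho>'_le
        by (intro vector_derivative_increment_le[OF _ der_\<rho>]) auto
      also have "\<dots> \<le> L * \<tau>"
        using that L by (intro mult_left_mono) auto
      finally show ?thesis .
    qed
    have lip: "C * (norm (\<xi> s - \<xi> t) + norm (\<rho> s - \<rho> t)) \<le> C * (C + L) * \<tau>" if "s \<in> {t..t + \<tau>}" for s
    proof -
      have "C * (norm (\<xi> s - \<xi> t) + norm (\<rho> s - \<rho> t)) \<le> C * (C * \<tau> + L * \<tau>)"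
        using inc_\<xi>[OF that] inc_\<rho>[OF that] C_nonneg by (intro mult_left_mono) auto
      then show ?thesis
        by (simp add: algebra_simps)
    qed
    have seg: "closed_segment t (t + \<tau>) \<subseteq> {t..t + \<tau>}"
      using t by (simp add: closed_segment_eq_real_ivl)
    have "norm (\<xi> (t + \<tau>) - \<xi> t - (t + \<tau> - t) *\<^sub>R (- Gp (\<xi> t) (\<rho> t)))
        \<le> norm (t + \<tau> - t) * (C * (C + L) * \<tau>)"
    proof (rule vector_differentiable_bound_linearization[OF der_\<xi> seg])
      fix s assume s: "s \<in> {t..t + \<tau>}"
      have "norm (Gp (\<xi> s) (\<rho> s) - Gp (\<xi> t) (\<rho> t)) \<le> C * (C + L) * \<tau>"
        using Gp_lipschitz[of "\<rho> s" "\<rho> t" "\<xi> s" "\<xi> t"] lip[OF s] \<rho>_le s t by auto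
      then show "norm (- Gp (\<xi> s) (\<rho> s) - - Gp (\<xi> t) (\<rho> t)) \<le> C * (C + L) * \<tau>"
        by (simp add: norm_minus_commute)
    qed (use t in auto)
    then have 1: "norm (\<xi> (t + \<tau>) - \<xi> t + \<tau> *\<^sub>R Gp (\<xi> t) (\<rho> t)) \<le> (C * (C + L)) * \<tau>\<^sup>2"
      using t by (simp add: power2_eq_square mult_ac)
    have "norm (\<rho> (t + \<tau>) - \<rho> t - (t + \<tau> - t) *\<^sub>R (Gx (\<xi> t) (\<rho> t) + \<epsilon> *\<^sub>R \<rho> t))
        \<le> norm (t + \<tau> - t) * (C * (C + L) * \<tau> + \<epsilon> * (L * \<tau>))"
    proof (rule vector_differentiable_bound_linearization[OF der_\<rho> seg])
      fix s assume s: "s \<in> {t..t + \<tau>}"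
      have "norm (Gx (\<xi> s) (\<rho> s) - Gx (\<xi> t) (\<rho> t)) \<le> C * (C + L) * \<tau>"
        using Gx_lipschitz[of "\<rho> s" "\<rho> t" "\<xi> s" "\<xi> t"] lip[OF s] \<rho>_le s t by auto
      moreover have "norm (\<epsilon> *\<^sub>R (\<rho> s - \<rho> t)) \<le> \<epsilon> * (L * \<tau>)"
        using inc_\<rho>[OF s] eps_pos by simp
      ultimately have "norm ((Gx (\<xi> s) (\<rho> s) - Gx (\<xi> t) (\<rho> t)) + \<epsilon> *\<^sub>R (\<rho> s - \<rho> t))
          \<le> C * (C + L) * \<tau> + \<epsilon> * (L * \<tau>)"
        by (rule norm_triangle_mono)
      then show "norm (Gx (\<xi> s) (\<rho> s) + \<epsilon> *\<^sub>R \<rho> s - (Gx (\<xi> t) (\<rho> t) + \<epsilon> *\<^sub>R \<rho> t))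
          \<le> C * (C + L) * \<tau> + \<epsilon> * (L * \<tau>)"
        by (simp add: algebra_simps)
    qed (use t in auto)
    then have 2: "norm (\<rho> (t + \<tau>) - \<rho> t - \<tau> *\<^sub>R (Gx (\<xi> t) (\<rho> t) + \<epsilon> *\<^sub>R \<rho> t))
        \<le> (C * (C + L) + \<epsilon> * L) * \<tau>\<^sup>2"
      using t by (simp add: power2_eq_square algebra_simps)
    \<comment> \<open>The difference between damping the new costate and damping the old one is also
      of second order.\<close>
    have 3: "norm ((\<epsilon> * \<tau>) *\<^sub>R (\<rho> (t + \<tau>) - \<rho> t)) \<le> (\<epsilon> * L) * \<tau>\<^sup>2"
    proof -
      have "\<bar>\<epsilon> * \<tau>\<bar> * norm (\<rho> (t + \<tau>) - \<rho> t) \<le> (\<epsilon> * \<tau>) * (L * \<tau>)"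
        using inc_\<rho>[of "t + \<tau>"] t eps_pos by (intro mult_mono) auto
      then show ?thesis
        by (simp add: power2_eq_square mult_ac)
    qed
    have "norm ((1 - \<epsilon> * \<tau>) *\<^sub>R \<rho> (t + \<tau>) - \<rho> t - \<tau> *\<^sub>R Gx (\<xi> t) (\<rho> t))
        = norm ((\<rho> (t + \<tau>) - \<rho> t - \<tau> *\<^sub>R (Gx (\<xi> t) (\<rho> t) + \<epsilon> *\<^sub>R \<rho> t))
            - (\<epsilon> * \<tau>) *\<^sub>R (\<rho> (t + \<tau>) - \<rho> t))"
      by (simp add: algebra_simps)
    also have "\<dots> \<le> (C * (C + L) + \<epsilon> * L) * \<tau>\<^sup>2 + (\<epsilon> * L) * \<tau>\<^sup>2"
      using 2 3 by (smt (verit) norm_triangle_ineq4)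
    finally have "norm ((1 - \<epsilon> * \<tau>) *\<^sub>R \<rho> (t + \<tau>) - \<rho> t - \<tau> *\<^sub>R Gx (\<xi> t) (\<rho> t)) \<le> B * \<tau>\<^sup>2"
      by (simp add: B_def algebra_simps)
    moreover have "(C * (C + L)) * \<tau>\<^sup>2 \<le> B * \<tau>\<^sup>2"
      using L eps_pos by (intro mult_right_mono) (auto simp: B_def)
    ultimately show ?thesis
      using 1 by linarith
  qed
  ultimately show ?thesis
    by blast
qed

section \<open>Vanishing time step\<close>

lemma defect_tendsto_0:
  assumes der: "(v has_derivative (\<lambda>k. D \<bullet> k)) (at x)" and "0 < T"
    and near: "\<forall>\<^sub>F N in sequentially. near_optimal x (T / real N) A E N (X N) (P N)"
    and A: "R + T * C + norm D \<le> A"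
  shows "(\<lambda>N. \<Sum>i<N. T / real N * norm (defect D (T / real N) (X N) (P N) i)) \<longlonglongrightarrow> 0"
proof -
  define Z where "Z N i = norm (defect D (T / real N) (X N) (P N) i)" for N i
  define B where "B = R + T * C + norm D"
  have B: "0 \<le> B"
    using K_nonneg K_le_R C_nonneg \<open>0 < T\<close> by (simp add: B_def)
  have L2: "(\<lambda>N. \<Sum>i<N. T / real N * (Z N i)\<^sup>2) \<longlonglongrightarrow> 0"
  proof (rule tendstoI)
    fix e :: real assume "0 < e"
    define W where "W = T * M * (B\<^sup>2 + (T * B)\<^sup>2)"
    have W: "0 \<le> W"
      using M_nonneg \<open>0 < T\<close> by (simp add: W_def)
    define e' where "e' = e / (4 * (T * B + 1))"
    have TB: "0 < T * B + 1"
      using B \<open>0 < T\<close> by (simp add: add_nonneg_pos)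
    then have e': "0 < e'"
      using \<open>0 < e\<close> by (simp add: e'_def)
    obtain d where d: "0 < d"
      "\<And>y. norm (y - x) < d \<Longrightarrow> norm (v y - v x - D \<bullet> (y - x)) \<le> e' * norm (y - x)"
      using der e' unfolding has_derivative_at_alt by blast
    \<comment> \<open>The amplitude r is fixed before \<open>N\<close>: it keeps the displacement of
      the first node inside the radius \<open>d\<close> of the linear approximation and the
      quadratic contribution below e / 4. Only then is \<open>N\<close> taken large enough for
      \<open>E * sqrt (T / N) / r\<close> to fall below e / 4.\<close>
    define r where "r = min 1 (min (d / (2 * (T * B + 1))) (e / (4 * (W + 1))))"
    have r: "0 < r" "r \<le> 1" "r \<le> d / (2 * (T * B + 1))" "r \<le> e / (4 * (W + 1))"
      using d(1) \<open>0 < e\<close> W TB by (auto simp: r_def)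
    have "r * (T * B + 1) \<le> d / 2"
      using r(3) TB by (simp add: field_simps)
    then have rd: "T * (r * B) < d"
      using r(1) d(1) by (simp add: algebra_simps)
    have "r * (W + 1) \<le> e / 4"
      using r(4) W by (simp add: field_simps)
    then have rW: "r * W < e / 4"
      using r(1) by (simp add: algebra_simps)
    have e'B: "e' * (T * B) < e / 4"
      using TB \<open>0 < e\<close> by (simp add: e'_def field_simps)
    have "(\<lambda>N. E * sqrt (T / real N) / r) \<longlonglongrightarrow> E * sqrt 0 / r"
      using r(1) by (intro tendsto_intros lim_const_over_n) auto
    then have "\<forall>\<^sub>F N in sequentially. E * sqrt (T / real N) / r < e / 4"
      using \<open>0 < e\<close> by (intro order_tendstoD(2)) auto
    moreover have "\<forall>\<^sub>F N in sequentially. \<epsilon> * T / real N < 1"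
      by (intro order_tendstoD[OF lim_const_over_n]) auto
    ultimately show "\<forall>\<^sub>F N in sequentially. dist (\<Sum>i<N. T / real N * (Z N i)\<^sup>2) 0 < e"
      using near eventually_gt_at_top[of 0]
    proof eventually_elim
      case (elim N)
      let ?\<tau> = "T / real N" and ?S = "\<Sum>i<N. T / real N * (Z N i)\<^sup>2"
      have "r * ?S \<le> e' * (T * (r * B)) + T * M * ((r * B)\<^sup>2 + (T * (r * B))\<^sup>2) + E * sqrt ?\<tau>"
        unfolding Z_def
      proof (rule defect_variation[OF elim(3) _ _ _ B_def])
        fix k :: 'a assume "norm k \<le> T * (r * B)"
        then show "D \<bullet> k - e' * norm k \<le> v (x + k) - v x"
          using d(2)[of "x + k"] rd by simp
      qed (use elim \<open>0 < T\<close> A r e' in \<open>auto simp: B_def\<close>)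
      also have "\<dots> = r * (e' * (T * B) + r * W + E * sqrt ?\<tau> / r)"
        using r(1) by (simp add: W_def field_simps power2_eq_square)
      finally have "?S \<le> e' * (T * B) + r * W + E * sqrt ?\<tau> / r"
        using r(1) by simp
      then have "?S < e"
        using elim(1) rW e'B \<open>0 < e\<close> by linarith
      moreover have "0 \<le> ?S"
        using \<open>0 < T\<close> by (intro sum_nonneg) auto
      ultimately show ?case
        by simp
    qed
  qed
  \<comment> \<open>Cauchy-Schwarz with total weight \<open>T\<close> passes from the mean square to
    the mean of the norms, which is the quantity in the stability estimate.\<close>
  have "(\<lambda>N. sqrt (T * (\<Sum>i<N. T / real N * (Z N i)\<^sup>2))) \<longlonglongrightarrow> sqrt (T * 0)"
    by (intro tendsto_intros L2)
  then have lim: "(\<lambda>N. sqrt (T * (\<Sum>i<N. T / real N * (Z N i)\<^sup>2))) \<longlonglongrightarrow> 0"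
    by simp
  have "(\<lambda>N. \<Sum>i<N. T / real N * Z N i) \<longlonglongrightarrow> 0"
  proof (rule tendsto_sandwich[OF _ _ tendsto_const lim])
    show "\<forall>\<^sub>F N in sequentially. 0 \<le> (\<Sum>i<N. T / real N * Z N i)"
      using \<open>0 < T\<close> by (intro always_eventually allI sum_nonneg) (auto simp: Z_def)
    show "\<forall>\<^sub>F N in sequentially. (\<Sum>i<N. T / real N * Z N i)
        \<le> sqrt (T * (\<Sum>i<N. T / real N * (Z N i)\<^sup>2))"
      using eventually_gt_at_top[of 0]
    proof eventually_elim
      case (elim N)
      have "(\<Sum>i<N. Z N i * 1)\<^sup>2 \<le> (\<Sum>i<N. (Z N i)\<^sup>2) * (\<Sum>i<N. 1\<^sup>2)"
        by (rule Cauchy_Schwarz_ineq_sum)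
      then have "(T / real N)\<^sup>2 * (\<Sum>i<N. Z N i)\<^sup>2 \<le> (T / real N)\<^sup>2 * ((\<Sum>i<N. (Z N i)\<^sup>2) * real N)"
        by (intro mult_left_mono) auto
      also have "\<dots> = T * (\<Sum>i<N. T / real N * (Z N i)\<^sup>2)"
        unfolding sum_distrib_left[symmetric] using elim by (simp add: power2_eq_square)
      finally show ?case
        by (intro real_le_rsqrt) (simp only: sum_distrib_left[symmetric] power_mult_distrib)
    qed
  qed
  then show ?thesis
    by (simp add: Z_def)
qed

text \<open>With the first node fixed, the left side of the first variation inequality is 0. Moving
  the last node by \<open>h\<close> leaves the discounted increment of \<open>v\<close>, minus the
  pairing of the discounted final costate with \<open>h\<close>, plus a quadratic term. In the limit
  nodes and costates are replaced by the characteristic.\<close>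

lemma characteristic_lower_bound:
  assumes der: "(v has_derivative (\<lambda>k. \<rho> 0 \<bullet> k)) (at (\<xi> 0))" and "0 < T"
    and \<xi>: "\<And>t. t \<in> {0..T} \<Longrightarrow> (\<xi> has_vector_derivative - Gp (\<xi> t) (\<rho> t)) (at t within {0..T})"
    and \<rho>: "\<And>t. t \<in> {0..T} \<Longrightarrow> (\<rho> has_vector_derivative Gx (\<xi> t) (\<rho> t) + \<epsilon> *\<^sub>R \<rho> t) (at t within {0..T})"
    and \<rho>_le: "\<And>t. t \<in> {0..T} \<Longrightarrow> norm (\<rho> t) \<le> R"
  shows "exp (- \<epsilon> * T) * (\<rho> T \<bullet> h) - T * M * ((norm h / T)\<^sup>2 + (norm h)\<^sup>2)
    \<le> exp (- \<epsilon> * T) * (v (\<xi> T + h) - v (\<xi> T))"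
proof -
  define D where "D = \<rho> 0"
  obtain B where B: "0 \<le> B"
    and cons: "\<And>t \<tau>. 0 \<le> t \<Longrightarrow> 0 \<le> \<tau> \<Longrightarrow> t + \<tau> \<le> T \<Longrightarrow>
      norm (\<xi> (t + \<tau>) - \<xi> t + \<tau> *\<^sub>R Gp (\<xi> t) (\<rho> t)) \<le> B * \<tau>\<^sup>2"
      "\<And>t \<tau>. 0 \<le> t \<Longrightarrow> 0 \<le> \<tau> \<Longrightarrow> t + \<tau> \<le> T \<Longrightarrow>
      norm ((1 - \<epsilon> * \<tau>) *\<^sub>R \<rho> (t + \<tau>) - \<rho> t - \<tau> *\<^sub>R Gx (\<xi> t) (\<rho> t)) \<le> B * \<tau>\<^sup>2"
    using characteristic_consistency[OF \<xi> \<rho> \<rho>_le] by metis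
  \<comment> \<open>The same orbits must admit two families of perturbations: those along the defect
    and the constant velocity that moves the last node by \<open>h\<close> within time
    \<open>T\<close>.\<close>
  define A where "A = max (R + T * C + norm D) (norm h / T)"
  have A: "R + T * C + norm D \<le> A" "norm h / T \<le> A" "0 \<le> A"
    using \<open>0 < T\<close> by (auto simp: A_def le_max_iff_disj)
  obtain E where "0 \<le> E" and E: "\<And>N \<tau>. 0 < \<tau> \<Longrightarrow> \<tau> \<le> 1 \<Longrightarrow> \<epsilon> * \<tau> \<le> 1 \<Longrightarrow> real N * \<tau> \<le> T \<Longrightarrow>
      \<exists>X P. near_optimal (\<xi> 0) \<tau> A E N X P"
    using near_optimal_exists[of T A "\<xi> 0"] \<open>0 < T\<close> A by auto
  have ev_\<tau>: "\<forall>\<^sub>F N in sequentially. 0 < T / real N \<and> T / real N \<le> 1 \<and> \<epsilon> * (T / real N) \<le> 1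
      \<and> real N * (T / real N) = T"
  proof -
    have "\<forall>\<^sub>F N in sequentially. T / real N < 1" "\<forall>\<^sub>F N in sequentially. \<epsilon> * T / real N < 1"
      by (intro order_tendstoD[OF lim_const_over_n]; simp)+
    then show ?thesis
      using eventually_gt_at_top[of 0] by eventually_elim (use \<open>0 < T\<close> in auto)
  qed
  \<comment> \<open>The step conditions fail for small \<open>N\<close>, including 0. Placing them
    in the premise of an implication lets orbits be chosen for all \<open>N\<close> at once.\<close>
  have "\<exists>X P. 0 < T / real N \<and> T / real N \<le> 1 \<and> \<epsilon> * (T / real N) \<le> 1 \<and> real N * (T / real N) = T
      \<longrightarrow> near_optimal (\<xi> 0) (T / real N) A E N X P" for N
    using E[of "T / real N" N] by (metis order_refl)
  then obtain X P where XP: "\<And>N. 0 < T / real N \<and> T / real N \<le> 1 \<and> \<epsilon> * (T / real N) \<le> 1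
      \<and> real N * (T / real N) = T \<Longrightarrow> near_optimal (\<xi> 0) (T / real N) A E N (X N) (P N)"
    by metis
  have near: "\<forall>\<^sub>F N in sequentially. near_optimal (\<xi> 0) (T / real N) A E N (X N) (P N)"
    using ev_\<tau> by (rule eventually_mono) (rule XP)
  define \<Theta> where "\<Theta> N = (\<Sum>i<N. T / real N * norm (defect D (T / real N) (X N) (P N) i))" for N
  have \<Theta>: "\<Theta> \<longlonglongrightarrow> 0"
    unfolding \<Theta>_def[abs_def] using der \<open>0 < T\<close> near A(1) unfolding D_def by (rule defect_tendsto_0)
  define \<kappa> where "\<kappa> N = (1 - \<epsilon> * (T / real N)) ^ N" for N
  have \<kappa>: "\<kappa> \<longlonglongrightarrow> exp (- \<epsilon> * T)"
    using tendsto_exp_limit_sequentially[of "- \<epsilon> * T"] by (simp add: \<kappa>_def[abs_def])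
  \<comment> \<open>Half the limit of the discount factors, hence eventually a strict lower bound
    for them.\<close>
  define k0 where "k0 = exp (- \<epsilon> * T) / 2"
  have "0 < k0"
    by (simp add: k0_def)
  have ev_\<kappa>: "\<forall>\<^sub>F N in sequentially. k0 < \<kappa> N"
    using \<kappa> by (rule order_tendstoD) (simp add: k0_def)
  define Q where "Q N = exp ((C + C / k0) * T)
      * (\<Theta> N / k0 + T * (T * B + (C + T * B) / k0) * (T / real N))" for N
  define err where "err N = C * Q N + T * B * (T / real N)" for N
  have "Q \<longlonglongrightarrow> exp ((C + C / k0) * T) * (0 / k0 + T * (T * B + (C + T * B) / k0) * 0)"
    unfolding Q_def using \<open>0 < k0\<close> by (intro tendsto_intros \<Theta> lim_const_over_n) auto
  then have "err \<longlonglongrightarrow> C * 0 + T * B * 0"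
    unfolding err_def by (intro tendsto_intros lim_const_over_n) auto
  then have err: "err \<longlonglongrightarrow> 0"
    by simp
  \<comment> \<open>The discounted costate that the momentum balance predicts at the last node; it
    replaces \<open>P\<close>, which is controlled only on average.\<close>
  define a where "a N = D + impulse (T / real N) (X N) (P N) N" for N
  have shadow: "\<forall>\<^sub>F N in sequentially. norm (X N N - \<xi> T) \<le> err N \<and> norm (a N - \<kappa> N *\<^sub>R \<rho> T) \<le> err N"
    using ev_\<tau> near ev_\<kappa>
  proof eventually_elim
    case (elim N)
    define \<tau> where "\<tau> = T / real N"
    have \<tau>: "0 < \<tau>" "\<epsilon> * \<tau> \<le> 1" "real N * \<tau> = T"
      using elim(1) by (auto simp: \<tau>_def)
    note nd = near_optimalD[OF elim(2), folded \<tau>_def]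
    have time: "0 \<le> real j * \<tau>" "real j * \<tau> \<le> T" if "j \<le> N" for j
    proof -
      have "real j * \<tau> \<le> real N * \<tau>"
        using that \<tau> by (intro mult_right_mono) auto
      then show "real j * \<tau> \<le> T" "0 \<le> real j * \<tau>"
        using \<tau> by auto
    qed
    have cx: "norm (\<xi> (real (Suc j) * \<tau>) - \<xi> (real j * \<tau>)
        + \<tau> *\<^sub>R Gp (\<xi> (real j * \<tau>)) (\<rho> (real j * \<tau>))) \<le> B * \<tau>\<^sup>2"
      and cp: "norm ((1 - \<epsilon> * \<tau>) *\<^sub>R \<rho> (real (Suc j) * \<tau>) - \<rho> (real j * \<tau>)
        - \<tau> *\<^sub>R Gx (\<xi> (real j * \<tau>)) (\<rho> (real j * \<tau>))) \<le> B * \<tau>\<^sup>2" if "j < N" for j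
      using cons[of "real j * \<tau>" \<tau>] time[of j] time[of "Suc j"] that \<tau>(1)
      by (auto simp: algebra_simps)
    note shadow = orbit_near_characteristic[where X = "X N" and P = "P N" and N = N and \<tau> = \<tau>
        and \<xi> = "\<lambda>j. \<xi> (real j * \<tau>)" and \<rho> = "\<lambda>j. \<rho> (real j * \<tau>)" and ?k0.0 = k0,
        OF _ nd(2) nd(3) _ cx cp \<tau> \<open>0 < k0\<close> _ B]
    have "norm (X N N - \<xi> (real N * \<tau>)) \<le> err N"
      unfolding err_def Q_def \<Theta>_def D_def \<tau>_def[symmetric]
      using shadow(1) nd(1) \<rho>_le time elim(3) by (auto simp: \<kappa>_def \<tau>_def)
    moreover have "norm (a N - \<kappa> N *\<^sub>R \<rho> (real N * \<tau>)) \<le> err N"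
      unfolding err_def Q_def \<Theta>_def D_def a_def \<kappa>_def \<tau>_def[symmetric]
      using shadow(2) nd(1) \<rho>_le time elim(3) by (auto simp: \<kappa>_def \<tau>_def)
    ultimately show ?case
      by (simp add: \<tau>(3))
  qed
  have X_lim: "(\<lambda>N. X N N) \<longlonglongrightarrow> \<xi> T"
    by (rule Lim_transform[OF tendsto_const])
      (rule Lim_null_comparison[OF eventually_mono[OF shadow] err], simp add: norm_minus_commute)
  have "(\<lambda>N. a N - \<kappa> N *\<^sub>R \<rho> T) \<longlonglongrightarrow> 0"
    by (rule Lim_null_comparison[OF eventually_mono[OF shadow] err]) simp
  then have "(\<lambda>N. (a N - \<kappa> N *\<^sub>R \<rho> T) + \<kappa> N *\<^sub>R \<rho> T) \<longlonglongrightarrow> 0 + exp (- \<epsilon> * T) *\<^sub>R \<rho> T"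
    by (intro tendsto_add tendsto_scaleR \<kappa> tendsto_const)
  then have a_lim: "a \<longlonglongrightarrow> exp (- \<epsilon> * T) *\<^sub>R \<rho> T"
    by simp
  have "\<forall>\<^sub>F N in sequentially. 0 \<le> \<kappa> N * (v (X N N + h) - v (X N N)) - a N \<bullet> h + norm h / T * \<Theta> N
      + T * M * ((norm h / T)\<^sup>2 + (norm h)\<^sup>2) + E * sqrt (T / real N)"
    using ev_\<tau> near
  proof eventually_elim
    case (elim N)
    define \<tau> where "\<tau> = T / real N"
    have \<tau>: "0 < \<tau>" "\<epsilon> * \<tau> \<le> 1" "real N * \<tau> = T"
      using elim(1) by (auto simp: \<tau>_def)
    note nd = near_optimalD[OF elim(2), folded \<tau>_def]
    \<comment> \<open>Nodes are numbered backwards, so a displacement growing from 0 to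
      \<open>h\<close> along the orbit has velocity perturbation \<open>- h / T\<close>.\<close>
    define \<eta> where "\<eta> j = (real j * \<tau> / T) *\<^sub>R h" for j
    define \<omega> where "\<omega> = - ((1 / T) *\<^sub>R h)"
    have \<eta>: "\<eta> 0 = 0" "\<eta> N = h" and \<eta>_step: "\<eta> j = \<eta> (Suc j) + \<tau> *\<^sub>R \<omega>" for j
      using \<tau>(3) \<open>0 < T\<close> by (simp_all add: \<eta>_def \<omega>_def algebra_simps add_divide_distrib)
    have \<omega>_norm: "norm \<omega> = norm h / T"
      using \<open>0 < T\<close> by (simp add: \<omega>_def)
    have \<eta>_le: "norm (\<eta> j) \<le> norm h" if "j < N" for j
    proof -
      have "real j * \<tau> \<le> real N * \<tau>"
        using that \<tau> by (intro mult_right_mono) auto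
      then have "\<bar>real j * \<tau> / T\<bar> \<le> 1"
        using \<tau> \<open>0 < T\<close> by simp
      then show ?thesis
        unfolding \<eta>_def norm_scaleR by (intro mult_left_le_one_le) auto
    qed
    have "v (\<xi> 0 + \<eta> 0) - v (\<xi> 0) \<le> (1 - \<epsilon> * \<tau>) ^ N * (v (X N N + \<eta> N) - v (X N N))
         + (\<Sum>j<N. \<tau> * (1 - \<epsilon> * \<tau>) ^ j * (P N j \<bullet> \<omega> - Gx (X N j) (P N j) \<bullet> \<eta> j
             + M * ((norm \<omega>)\<^sup>2 + (norm (\<eta> j))\<^sup>2))) + E * sqrt \<tau>"
      by (rule nd(4)[of "\<lambda>_. \<omega>" \<eta>]) (use \<omega>_norm A(2) in simp, rule \<eta>_step)
    also have "\<dots> = (1 - \<epsilon> * \<tau>) ^ N * (v (X N N + \<eta> N) - v (X N N))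
         + (\<Sum>j<N. \<tau> * (1 - \<epsilon> * \<tau>) ^ j * (P N j \<bullet> \<omega> - Gx (X N j) (P N j) \<bullet> \<eta> j))
         + (\<Sum>j<N. \<tau> * (1 - \<epsilon> * \<tau>) ^ j * (M * ((norm \<omega>)\<^sup>2 + (norm (\<eta> j))\<^sup>2))) + E * sqrt \<tau>"
      unfolding distrib_left[of "_ * _ ^ _" "_ - _"] sum.distrib by simp
    also have "(\<Sum>j<N. \<tau> * (1 - \<epsilon> * \<tau>) ^ j * (P N j \<bullet> \<omega> - Gx (X N j) (P N j) \<bullet> \<eta> j))
        = D \<bullet> \<eta> 0 - (D + impulse \<tau> (X N) (P N) N) \<bullet> \<eta> N
          + (\<Sum>i<N. \<tau> * (\<omega> \<bullet> defect D \<tau> (X N) (P N) i))"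
      by (rule first_variation_eq) (rule \<eta>_step)
    also have "(\<Sum>i<N. \<tau> * (\<omega> \<bullet> defect D \<tau> (X N) (P N) i))
        \<le> (\<Sum>i<N. \<tau> * (norm \<omega> * norm (defect D \<tau> (X N) (P N) i)))"
      using \<tau>(1) by (intro sum_mono mult_left_mono norm_cauchy_schwarz) auto
    also have "\<dots> = norm h / T * \<Theta> N"
      by (simp add: \<omega>_norm \<Theta>_def \<tau>_def[symmetric] sum_distrib_left mult_ac)
    also have "(\<Sum>j<N. \<tau> * (1 - \<epsilon> * \<tau>) ^ j * (M * ((norm \<omega>)\<^sup>2 + (norm (\<eta> j))\<^sup>2)))
        \<le> T * M * ((norm h / T)\<^sup>2 + (norm h)\<^sup>2)"
      by (rule quadratic_remainder_le) (use \<tau> \<eta>_le \<omega>_norm \<open>0 < T\<close> in auto)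
    finally show ?case
      by (simp add: \<eta> \<kappa>_def a_def \<tau>_def[symmetric])
  qed
  moreover have "(\<lambda>N. \<kappa> N * (v (X N N + h) - v (X N N)) - a N \<bullet> h + norm h / T * \<Theta> N
      + T * M * ((norm h / T)\<^sup>2 + (norm h)\<^sup>2) + E * sqrt (T / real N))
    \<longlonglongrightarrow> exp (- \<epsilon> * T) * (v (\<xi> T + h) - v (\<xi> T)) - (exp (- \<epsilon> * T) *\<^sub>R \<rho> T) \<bullet> h + norm h / T * 0
      + T * M * ((norm h / T)\<^sup>2 + (norm h)\<^sup>2) + E * sqrt 0"
  proof -
    have "K-lipschitz_on UNIV v"
      using v_lipschitz K_nonneg by (auto intro!: lipschitz_onI simp: dist_norm)
    then have "continuous_on UNIV v"
      by (rule lipschitz_on_continuous_on)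
    then have cont: "(\<lambda>N. v (y N)) \<longlonglongrightarrow> v l" if "y \<longlonglongrightarrow> l" for y l
      using that by (simp add: continuous_on_eq_continuous_at isCont_tendsto_compose)
    show ?thesis
      by (intro tendsto_intros \<kappa> a_lim \<Theta> lim_const_over_n cont X_lim)
  qed
  ultimately have "0 \<le> exp (- \<epsilon> * T) * (v (\<xi> T + h) - v (\<xi> T)) - (exp (- \<epsilon> * T) *\<^sub>R \<rho> T) \<bullet> h + norm h / T * 0
      + T * M * ((norm h / T)\<^sup>2 + (norm h)\<^sup>2) + E * sqrt 0"
    using tendsto_lowerbound[OF _ _ sequentially_bot] by blast
  then show ?thesis
    by simp
qed

theorem gradient_along_characteristic:
  assumes der: "(v has_derivative (\<lambda>k. \<rho> 0 \<bullet> k)) (at (\<xi> 0))" and "0 < T"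
    and \<xi>: "\<And>t. t \<in> {0..T} \<Longrightarrow> (\<xi> has_vector_derivative - Gp (\<xi> t) (\<rho> t)) (at t within {0..T})"
    and \<rho>: "\<And>t. t \<in> {0..T} \<Longrightarrow> (\<rho> has_vector_derivative Gx (\<xi> t) (\<rho> t) + \<epsilon> *\<^sub>R \<rho> t) (at t within {0..T})"
    and \<rho>_le: "\<And>t. t \<in> {0..T} \<Longrightarrow> norm (\<rho> t) \<le> R"
  shows "(v has_derivative (\<lambda>k. \<rho> T \<bullet> k)) (at (\<xi> T))"
proof -
  define B where "B = T * M * (1 / T\<^sup>2 + 1) / exp (- \<epsilon> * T)"
  have lower: "- B * (norm k)\<^sup>2 \<le> v (\<xi> T + k) - v (\<xi> T) - \<rho> T \<bullet> k" for k
  proof -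
    have "exp (- \<epsilon> * T) * B = T * M * (1 / T\<^sup>2 + 1)"
      by (simp add: B_def)
    then have "exp (- \<epsilon> * T) * (- B * (norm k)\<^sup>2) = - (T * M * (1 / T\<^sup>2 + 1)) * (norm k)\<^sup>2"
      by simp
    also have "\<dots> = - (T * M * ((norm k / T)\<^sup>2 + (norm k)\<^sup>2))"
      by (simp add: power_divide algebra_simps)
    also have "\<dots> \<le> exp (- \<epsilon> * T) * (v (\<xi> T + k) - v (\<xi> T) - \<rho> T \<bullet> k)"
      using characteristic_lower_bound[OF assms, of k] by (simp add: algebra_simps)
    finally show ?thesis
      by (simp only: mult_le_cancel_left_pos exp_gt_zero)
  qed
  \<comment> \<open>The lower bound at -k, inserted into the semiconcavity inequality, becomes an
    upper bound at k.\<close>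
  have "\<bar>v (\<xi> T + k) - v (\<xi> T) - \<rho> T \<bullet> k\<bar> \<le> (4 * M + B) * (norm k)\<^sup>2" for k
  proof -
    have "0 \<le> 4 * M * (norm k)\<^sup>2"
      using M_nonneg by simp
    moreover have "- B * (norm k)\<^sup>2 \<le> v (\<xi> T - k) - v (\<xi> T) + \<rho> T \<bullet> k"
      using lower[of "- k"] by simp
    ultimately show ?thesis
      using lower[of k] semiconcave[of "\<xi> T" k] unfolding distrib_right abs_le_iff by auto
  qed
  then show ?thesis
    by (rule has_derivative_of_quadratic_bound)
qed

end

section \<open>Uniform estimates for periodic Hamiltonians\<close>

lemma periodic_derivative:
  fixes f :: "'a::real_normed_vector \<Rightarrow> 'b::real_normed_vector"
  assumes per: "\<And>z. f (z + a) = f z" and der: "\<And>z. (f has_derivative blinfun_apply (f' z)) (at z)"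
  shows "f' (z + a) = f' z"
proof -
  have "((\<lambda>y. f (y + a)) has_derivative (\<lambda>k. f' (z + a) k)) (at z)"
    by (rule has_derivative_compose[where g = f and f = "\<lambda>y. y + a", OF _ der])
      (auto intro!: derivative_eq_intros)
  then have "(f has_derivative f' (z + a)) (at z)"
    by (simp add: per)
  from has_derivative_unique[OF this der] show ?thesis
    by (simp add: blinfun_apply_inject)
qed

lemma exists_int_vec_translate:
  fixes x :: "real ^ 'n"
  shows "\<exists>k. int_vec k \<and> x + k \<in> cbox 0 1"
  by (intro exI[of _ "\<chi> i. - of_int \<lfloor>x $ i\<rfloor>"])
    (auto simp: int_vec_def mem_box_cart frac_def[symmetric] frac_lt_1 less_imp_le)

text \<open>Compactness of the torus, expressed by translating the base point into the unit
  cube.\<close>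

lemma periodic_bounded:
  fixes g :: "(real ^ 'n) \<times> ('b::euclidean_space) \<Rightarrow> 'c::real_normed_vector"
  assumes "continuous_on UNIV g" and per: "\<And>x p k. int_vec k \<Longrightarrow> g (x + k, p) = g (x, p)"
  shows "\<exists>B\<ge>0. \<forall>x p. norm p \<le> R \<longrightarrow> norm (g (x, p)) \<le> B"
proof -
  have "compact (g ` (cbox 0 1 \<times> cball 0 R))"
    using assms(1) by (intro compact_continuous_image compact_Times compact_cbox compact_cball)
      (auto elim: continuous_on_subset)
  then obtain B where "0 < B" and B: "\<And>y. y \<in> g ` (cbox 0 1 \<times> cball 0 R) \<Longrightarrow> norm y \<le> B"
    using compact_imp_bounded bounded_pos by metis
  have "norm (g (x, p)) \<le> B" if "norm p \<le> R" for x p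
  proof -
    obtain k where "int_vec k" "x + k \<in> cbox 0 1"
      using exists_int_vec_translate by blast
    then have "norm (g (x + k, p)) \<le> B"
      using that by (intro B imageI) auto
    then show ?thesis
      using per[OF \<open>int_vec k\<close>] by simp
  qed
  then show ?thesis
    using \<open>0 < B\<close> less_imp_le by blast
qed

lemma inner_grad:
  assumes "(u has_derivative u') (at x)"
  shows "grad u x \<bullet> k = u' k"
proof -
  interpret u': linear u'
    using assms by (rule has_derivative_linear)
  have "grad u x \<bullet> k = (\<Sum>i\<in>UNIV. u' (axis i 1) * k $ i)"
    using frechet_derivative_at[OF assms] by (simp add: grad_def inner_vec_def)
  also have "\<dots> = u' (\<Sum>i\<in>UNIV. k $ i *\<^sub>R axis i 1)"
    by (simp add: u'.sum u'.scaleR mult.commute)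
  also have "(\<Sum>i\<in>UNIV. k $ i *\<^sub>R axis i 1) = k"
    using basis_expansion[of k] by (simp add: scalar_mult_eq_scaleR)
  finally show ?thesis .
qed

lemma norm_le_of_inner_le:
  fixes a :: "'a::real_inner"
  assumes "\<And>k. a \<bullet> k \<le> B * norm k" "0 \<le> B"
  shows "norm a \<le> B"
proof (cases "a = 0")
  case False
  have "norm a * norm a \<le> B * norm a"
    using assms(1)[of a] by (simp add: power2_norm_eq_inner[symmetric] power2_eq_square)
  then show ?thesis
    using False by simp
qed (use assms in simp)

lemma second_order_lower_bound:
  fixes \<phi> \<phi>' \<phi>'' :: "real \<Rightarrow> real"
  assumes d1: "\<And>t. (\<phi> has_real_derivative \<phi>' t) (at t)"
    and d2: "\<And>t. (\<phi>' has_real_derivative \<phi>'' t) (at t)"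
    and m: "\<And>t. 0 \<le> t \<Longrightarrow> t \<le> 1 \<Longrightarrow> m \<le> \<phi>'' t"
  shows "\<phi> 0 + \<phi>' 0 + m / 2 \<le> \<phi> 1"
proof -
  have mono: "\<phi>' 0 + m * t \<le> \<phi>' t" if "0 \<le> t" "t \<le> 1" for t
  proof -
    have "\<phi>' 0 - m * 0 \<le> \<phi>' t - m * t"
    proof (rule DERIV_nonneg_imp_nondecreasing[OF that(1)])
      fix s assume "0 \<le> s" "s \<le> t"
      then show "\<exists>y. ((\<lambda>s. \<phi>' s - m * s) has_real_derivative y) (at s) \<and> 0 \<le> y"
        using m[of s] that by (intro exI[of _ "\<phi>'' s - m"]) (auto intro!: derivative_eq_intros d2)
    qed
    then show ?thesis by simp
  qed
  have "\<phi> 0 - \<phi>' 0 * 0 - m / 2 * 0\<^sup>2 \<le> \<phi> 1 - \<phi>' 0 * 1 - m / 2 * 1\<^sup>2"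
  proof (rule DERIV_nonneg_imp_nondecreasing[OF zero_le_one])
    fix s :: real assume "0 \<le> s" "s \<le> 1"
    then show "\<exists>y. ((\<lambda>s. \<phi> s - \<phi>' 0 * s - m / 2 * s\<^sup>2) has_real_derivative y) (at s) \<and> 0 \<le> y"
      using mono[of s] by (intro exI[of _ "\<phi>' s - \<phi>' 0 - m * s"]) (auto intro!: derivative_eq_intros d1)
  qed
  then show ?thesis by simp
qed

text \<open>The first and second derivatives are periodic together with \<open>H\<close>, hence
  bounded on each momentum ball. Since the set of all positions times such a ball is convex, these
  bounds become Lipschitz constants by the mean value inequality.\<close>

lemma hamiltonian_estimates:
  fixes H :: "real ^ 'n \<Rightarrow> real ^ 'n \<Rightarrow> real"
  assumes H_C2: "C2_map (\<lambda>z::(real ^ 'n) \<times> (real ^ 'n). H (fst z) (snd z))"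
    and H_per: "\<And>x p k. int_vec k \<Longrightarrow> H (x + k) p = H x p"
    and H_convex: "Hpp_pos_def H"
  obtains C \<mu> where "0 \<le> C" "0 < \<mu>"
    and "\<And>x y p. norm p \<le> R \<Longrightarrow> \<bar>H x p - H y p\<bar> \<le> C * norm (x - y)"
    and "\<And>x p. norm p \<le> R \<Longrightarrow> norm (Hx H x p) \<le> C"
    and "\<And>x p. norm p \<le> R \<Longrightarrow> norm (Hp H x p) \<le> C"
    and "\<And>x p x' p'. norm p \<le> R \<Longrightarrow> norm p' \<le> R \<Longrightarrow>
      norm (Hx H x p - Hx H x' p') \<le> C * (norm (x - x') + norm (p - p'))"
    and "\<And>x p x' p'. norm p \<le> R \<Longrightarrow> norm p' \<le> R \<Longrightarrow>
      norm (Hp H x p - Hp H x' p') \<le> C * (norm (x - x') + norm (p - p'))"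
    and "\<And>x p x' p'. norm p \<le> R \<Longrightarrow> norm p' \<le> R \<Longrightarrow>
      H x p + Hp H x p \<bullet> (p' - p) + Hx H x p \<bullet> (x' - x) + \<mu> * (norm (p' - p))\<^sup>2
        - C * norm (p' - p) * norm (x' - x) - C * (norm (x' - x))\<^sup>2 \<le> H x' p'"
proof -
  define f where "f = (\<lambda>z::(real ^ 'n) \<times> (real ^ 'n). H (fst z) (snd z))"
  obtain f' where f': "\<And>z. (f has_derivative blinfun_apply (f' z)) (at z)" and "C1_map f'"
    using H_C2 unfolding C2_map_def f_def by blast
  then obtain f'' where f'': "\<And>z. (f' has_derivative blinfun_apply (f'' z)) (at z)"
    and f''_cont: "continuous_on UNIV f''"
    unfolding C1_map_def by blast
  have f'_cont: "continuous_on UNIV f'"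
    by (rule has_derivative_continuous_on[OF has_derivative_at_withinI[OF f'']])
  have f'_per: "f' (x + k, p) = f' (x, p)" if "int_vec k" for x p k
    using periodic_derivative[of f "(k, 0)", OF _ f', of "(x, p)"] H_per[OF that] by (simp add: f_def)
  have f''_per: "f'' (x + k, p) = f'' (x, p)" if "int_vec k" for x p k
    using periodic_derivative[of f' "(k, 0)", OF _ f'', of "(x, p)"] f'_per[OF that]
    by (simp add: split_paired_all)
  obtain C1 where C1: "0 \<le> C1" "\<And>x p. norm p \<le> R \<Longrightarrow> norm (f' (x, p)) \<le> C1"
    using periodic_bounded[OF f'_cont f'_per] by metis
  obtain C2 where C2: "0 \<le> C2" "\<And>x p. norm p \<le> R \<Longrightarrow> norm (f'' (x, p)) \<le> C2"
    using periodic_bounded[OF f''_cont f''_per] by metis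
  define C where "C = C1 + C2"
  have C: "0 \<le> C" "C1 \<le> C" "C2 \<le> C"
    using C1(1) C2(1) by (auto simp: C_def)

  have Hx: "Hx H x p \<bullet> k = f' (x, p) (k, 0)" for x p k
  proof -
    have "((\<lambda>y. f (y, p)) has_derivative (\<lambda>k. f' (x, p) (k, 0))) (at x)"
      by (rule has_derivative_compose[where g = f and f = "\<lambda>y. (y, p)", OF _ f'])
        (auto intro!: derivative_eq_intros)
    then have "((\<lambda>y. H y p) has_derivative (\<lambda>k. f' (x, p) (k, 0))) (at x)"
      by (simp add: f_def)
    then show ?thesis
      unfolding Hx_def by (rule inner_grad)
  qed
  have Hp: "Hp H x p \<bullet> k = f' (x, p) (0, k)" for x p k
  proof -
    have "((\<lambda>q. f (x, q)) has_derivative (\<lambda>k. f' (x, p) (0, k))) (at p)"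
      by (rule has_derivative_compose[where g = f and f = "\<lambda>q. (x, q)", OF _ f'])
        (auto intro!: derivative_eq_intros)
    then have "((\<lambda>q. H x q) has_derivative (\<lambda>k. f' (x, p) (0, k))) (at p)"
      by (simp add: f_def)
    then show ?thesis
      unfolding Hp_def by (rule inner_grad)
  qed
  have f'_apply: "((\<lambda>q. f' (x, q) w) has_derivative (\<lambda>k. f'' (x, p) (0, k) w)) (at p)" for x p w
  proof -
    have "((\<lambda>q. f' (x, q)) has_derivative (\<lambda>k. f'' (x, p) (0, k))) (at p)"
      by (rule has_derivative_compose[where g = f' and f = "\<lambda>q. (x, q)", OF _ f''])
        (auto intro!: derivative_eq_intros)
    then show ?thesis
      by (rule bounded_linear.has_derivative[OF blinfun.bounded_linear_left])
  qed
  \<comment> \<open>Rewrites the convexity hypothesis through the second derivative of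
    \<open>f\<close> on phase space, whose continuity allows a compactness argument.\<close>
  have Hpp: "frechet_derivative (\<lambda>q. Hp H x q) (at p) w \<bullet> w = f'' (x, p) (0, w) (0, w)" for x p w
  proof -
    have "Hp H x q = (\<Sum>b\<in>Basis. f' (x, q) (0, b) *\<^sub>R b)" for q
      using euclidean_representation[of "Hp H x q"] by (simp add: Hp)
    then have "(\<lambda>q. Hp H x q) = (\<lambda>q. \<Sum>b\<in>Basis. f' (x, q) (0, b) *\<^sub>R b)"
      by blast
    then have "((\<lambda>q. Hp H x q) has_derivative (\<lambda>k. \<Sum>b\<in>Basis. f'' (x, p) (0, k) (0, b) *\<^sub>R b)) (at p)"
      by (simp only:) (intro has_derivative_sum has_derivative_scaleR_left f'_apply)
    from frechet_derivative_at[OF this, symmetric]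
    have "frechet_derivative (\<lambda>q. Hp H x q) (at p) w \<bullet> w
        = (\<Sum>b\<in>Basis. f'' (x, p) (0, w) (0, b) *\<^sub>R b) \<bullet> w"
      by simp
    also have "\<dots> = f'' (x, p) (0, w) (\<Sum>b\<in>Basis. (w \<bullet> b) *\<^sub>R (0, b))"
      by (simp add: inner_sum_left blinfun.sum_right blinfun.scaleR_right inner_commute[of w] mult.commute
          del: scaleR_Pair)
    also have "(\<Sum>b\<in>Basis. (w \<bullet> b) *\<^sub>R ((0::real^'n), b)) = (0, w)"
      by (simp add: prod_eq_iff fst_sum snd_sum euclidean_representation)
    finally show ?thesis .
  qed
  \<comment> \<open>Minimising over base points, momenta and unit directions gives the convexity
    modulus. The absolute value of \<open>R\<close> keeps the set nonempty whatever the sign of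
    \<open>R\<close>.\<close>
  define S where "S = (cbox (0::real^'n) 1 \<times> cball (0::real^'n) \<bar>R\<bar>) \<times> sphere (0::real^'n) 1"
  have "compact S"
    unfolding S_def by (intro compact_Times compact_cbox compact_cball compact_sphere)
  moreover have "S \<noteq> {}"
  proof -
    have "((0, 0), axis undefined 1) \<in> S"
      by (simp add: S_def mem_box_cart)
    then show ?thesis by blast
  qed
  moreover have "continuous_on S (\<lambda>y. f'' (fst y) (0, snd y) (0, snd y))"
    by (intro continuous_intros continuous_on_compose2[OF f''_cont]) auto
  ultimately have "\<exists>y0\<in>S. \<forall>y\<in>S. f'' (fst y0) (0, snd y0) (0, snd y0) \<le> f'' (fst y) (0, snd y) (0, snd y)"
    by (rule continuous_attains_inf)
  then obtain y0 where y0: "y0 \<in> S"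
    "\<And>y. y \<in> S \<Longrightarrow> f'' (fst y0) (0, snd y0) (0, snd y0) \<le> f'' (fst y) (0, snd y) (0, snd y)"
    by blast
  define m where "m = f'' (fst y0) (0, snd y0) (0, snd y0)"
  have "snd y0 \<noteq> 0"
    using y0(1) by (auto simp: S_def)
  then have "0 < m"
    using H_convex Hpp[of "fst (fst y0)" "snd (fst y0)" "snd y0"]
    by (simp add: Hpp_pos_def_def m_def) metis
  have Hpp_ge: "m * (norm w)\<^sup>2 \<le> f'' (x, p) (0, w) (0, w)" if "norm p \<le> R" for x p w
  proof (cases "w = 0")
    case True
    then show ?thesis
      by (simp add: blinfun.zero_right flip: zero_prod_def)
  next
    case False
    define e where "e = (1 / norm w) *\<^sub>R w"
    have "norm e = 1" and w: "(0, w) = norm w *\<^sub>R (0, e)"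
      using False by (auto simp: e_def)
    obtain k where k: "int_vec k" "x + k \<in> cbox 0 1"
      using exists_int_vec_translate by blast
    then have "((x + k, p), e) \<in> S"
      using that \<open>norm e = 1\<close> by (auto simp: S_def)
    then have "m \<le> f'' (x, p) (0, e) (0, e)"
      using y0(2) f''_per[OF k(1)] by (fastforce simp: m_def)
    then have "(norm w)\<^sup>2 * m \<le> (norm w)\<^sup>2 * f'' (x, p) (0, e) (0, e)"
      by (intro mult_left_mono) auto
    moreover have "f'' (x, p) (0, w) (0, w) = (norm w)\<^sup>2 * f'' (x, p) (0, e) (0, e)"
      unfolding w blinfun.scaleR_right blinfun.scaleR_left by (simp add: power2_eq_square)
    ultimately show ?thesis
      by (simp add: mult.commute)
  qed

  have convex: "convex ((UNIV :: (real ^ 'n) set) \<times> cball (0 :: real ^ 'n) R)"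
    by (intro convex_Times convex_cball convex_UNIV)
  have f_lip: "\<bar>f z - f z'\<bar> \<le> C * norm (z - z')" if "norm (snd z) \<le> R" "norm (snd z') \<le> R" for z z'
  proof -
    have "norm (f z - f z') \<le> C * norm (z - z')"
    proof (rule differentiable_bound[OF convex])
      show "onorm (f' y) \<le> C" if "y \<in> UNIV \<times> cball 0 R" for y
        using that C1(2)[of "snd y" "fst y"] C by (auto simp: norm_blinfun.rep_eq)
    qed (use that has_derivative_at_withinI[OF f'] in \<open>auto simp: mem_Times_iff\<close>)
    then show ?thesis by simp
  qed
  have f'_lip: "norm (f' z - f' z') \<le> C * norm (z - z')" if "norm (snd z) \<le> R" "norm (snd z') \<le> R" for z z'
  proof (rule differentiable_bound[OF convex])
    show "onorm (f'' y) \<le> C" if "y \<in> UNIV \<times> cball 0 R" for y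
      using that C2(2)[of "snd y" "fst y"] C by (auto simp: norm_blinfun.rep_eq)
  qed (use that has_derivative_at_withinI[OF f''] in \<open>auto simp: mem_Times_iff\<close>)
  have f'_lip': "norm (f' (x, p) - f' (x', p')) \<le> C * (norm (x - x') + norm (p - p'))"
    if "norm p \<le> R" "norm p' \<le> R" for x p x' p'
  proof -
    have "norm (f' (x, p) - f' (x', p')) \<le> C * norm (x - x', p - p')"
      using f'_lip[of "(x, p)" "(x', p')"] that by simp
    also have "\<dots> \<le> C * (norm (x - x') + norm (p - p'))"
      using C(1) by (intro mult_left_mono norm_Pair_le)
    finally show ?thesis .
  qed
  have apply_le: "A z \<le> B * norm k" if "norm A \<le> B" "norm z = norm k"
    for A :: "((real ^ 'n) \<times> (real ^ 'n)) \<Rightarrow>\<^sub>L real" and B z and k :: "real ^ 'n"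
  proof -
    have "A z \<le> norm A * norm z"
      using norm_blinfun[of A z] by simp
    also have "\<dots> \<le> B * norm k"
      using that by (simp add: mult_right_mono)
    finally show ?thesis .
  qed
  show thesis
  proof (rule that[OF C(1), of "m / 2"])
    show "0 < m / 2"
      using \<open>0 < m\<close> by simp
    show "\<bar>H x p - H y p\<bar> \<le> C * norm (x - y)" if "norm p \<le> R" for x y p
      using f_lip[of "(x, p)" "(y, p)"] that by (simp add: f_def)
    show "norm (Hx H x p) \<le> C" if "norm p \<le> R" for x p
      using C1(2)[OF that, of x] C
      by (intro norm_le_of_inner_le) (auto simp: Hx intro!: apply_le)
    show "norm (Hp H x p) \<le> C" if "norm p \<le> R" for x p
      using C1(2)[OF that, of x] C
      by (intro norm_le_of_inner_le) (auto simp: Hp intro!: apply_le)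
    show Hx_lip: "norm (Hx H x p - Hx H x' p') \<le> C * (norm (x - x') + norm (p - p'))"
      if "norm p \<le> R" "norm p' \<le> R" for x p x' p'
      using f'_lip'[OF that, of x x']
      by (intro norm_le_of_inner_le)
        (auto simp: Hx inner_diff_left C(1) simp flip: blinfun.diff_left intro!: apply_le)
    show "norm (Hp H x p - Hp H x' p') \<le> C * (norm (x - x') + norm (p - p'))"
      if "norm p \<le> R" "norm p' \<le> R" for x p x' p'
      using f'_lip'[OF that, of x x']
      by (intro norm_le_of_inner_le)
        (auto simp: Hp inner_diff_left C(1) simp flip: blinfun.diff_left intro!: apply_le)
    \<comment> \<open>Two moves: first in the momentum at fixed \<open>x\<close>, where Taylor's
      formula with the modulus \<open>m\<close> gives \<open>m / 2\<close>, then in the position at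
      fixed \<open>p'\<close>, with a quadratic error. Replacing \<open>Hx\<close> at
      \<open>p'\<close> by \<open>Hx\<close> at \<open>p\<close> produces the mixed term.\<close>
    show "H x p + Hp H x p \<bullet> (p' - p) + Hx H x p \<bullet> (x' - x) + m / 2 * (norm (p' - p))\<^sup>2
        - C * norm (p' - p) * norm (x' - x) - C * (norm (x' - x))\<^sup>2 \<le> H x' p'"
      if p: "norm p \<le> R" "norm p' \<le> R" for x p x' p'
    proof -
      define d where "d = p' - p"
      define e where "e = x' - x"
      have scale: "(0, s *\<^sub>R d) = s *\<^sub>R ((0 :: real ^ 'n), d)" for s
        by simp
      have "norm (p + t *\<^sub>R d) \<le> R" if "0 \<le> t" "t \<le> 1" for t
      proof -
        have "p + t *\<^sub>R d \<in> cball 0 R"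
          using convexD[OF convex_cball[of "0 :: real ^ 'n" R], of p p' "1 - t" t] p that
          by (simp add: d_def algebra_simps)
        then show ?thesis by simp
      qed
      moreover have "((\<lambda>t. H x (p + t *\<^sub>R d)) has_real_derivative f' (x, p + t *\<^sub>R d) (0, d)) (at t)" for t
      proof -
        have "((\<lambda>t. f (x, p + t *\<^sub>R d)) has_derivative (\<lambda>s. f' (x, p + t *\<^sub>R d) (0, s *\<^sub>R d))) (at t)"
          by (rule has_derivative_compose[where g = f and f = "\<lambda>t. (x, p + t *\<^sub>R d)", OF _ f'])
            (auto intro!: derivative_eq_intros)
        then have "((\<lambda>t. H x (p + t *\<^sub>R d)) has_derivative (\<lambda>s. f' (x, p + t *\<^sub>R d) (0, s *\<^sub>R d))) (at t)"
          by (simp add: f_def)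
        then show ?thesis
          by (rule has_derivative_imp_has_field_derivative)
            (simp only: scale blinfun.scaleR_right real_scaleR_def)
      qed
      moreover have "((\<lambda>t. f' (x, p + t *\<^sub>R d) (0, d)) has_real_derivative
          f'' (x, p + t *\<^sub>R d) (0, d) (0, d)) (at t)" for t
      proof -
        have "((\<lambda>t. f' (x, p + t *\<^sub>R d) (0, d)) has_derivative
            (\<lambda>s. f'' (x, p + t *\<^sub>R d) (0, s *\<^sub>R d) (0, d))) (at t)"
          by (rule has_derivative_compose[where g = "\<lambda>q. f' (x, q) (0, d)" and f = "\<lambda>t. p + t *\<^sub>R d", OF _ f'_apply])
            (auto intro!: derivative_eq_intros)
        then show ?thesis
          by (rule has_derivative_imp_has_field_derivative)
            (simp only: scale blinfun.scaleR_right blinfun.scaleR_left real_scaleR_def)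
      qed
      ultimately have "H x (p + 0 *\<^sub>R d) + f' (x, p + 0 *\<^sub>R d) (0, d) + (m * (norm d)\<^sup>2) / 2 \<le> H x (p + 1 *\<^sub>R d)"
        by (intro second_order_lower_bound[where \<phi> = "\<lambda>t. H x (p + t *\<^sub>R d)" and
              \<phi>' = "\<lambda>t. f' (x, p + t *\<^sub>R d) (0, d)"]) (auto intro: Hpp_ge)
      then have 1: "H x p + Hp H x p \<bullet> d + m / 2 * (norm d)\<^sup>2 \<le> H x p'"
        by (simp add: Hp d_def)
      have "norm (f (x', p') - f (x, p') - f' (x, p') ((x', p') - (x, p'))) \<le> norm ((x', p') - (x, p')) * (C * norm e)"
      proof (rule differentiable_bound_linearization)
        show "(x, p') + t *\<^sub>R ((x', p') - (x, p')) \<in> closed_segment (x, p') (x', p')" if "t \<in> {0..1}" for t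
          using that by (auto simp: closed_segment_def algebra_simps intro!: exI[of _ t])
        show "(f has_derivative f' z) (at z within closed_segment (x, p') (x', p'))" for z
          using f' by (rule has_derivative_at_withinI)
        show "onorm (blinfun_apply (f' z) - blinfun_apply (f' (x, p'))) \<le> C * norm e"
          if z: "z \<in> closed_segment (x, p') (x', p')" for z
        proof -
          obtain u where u: "0 \<le> u" "u \<le> 1" "z = (x + u *\<^sub>R e, p')"
            using z by (auto simp: closed_segment_def e_def algebra_simps simp flip: scaleR_left_distrib)
          have "norm (f' z - f' (x, p')) \<le> C * (norm (u *\<^sub>R e) + norm (p' - p'))"
            using f'_lip'[OF p(2) p(2), of "x + u *\<^sub>R e" x] u by simp
          also have "\<dots> \<le> C * norm e"
            using C(1) u by (intro mult_left_mono) (auto intro: mult_left_le_one_le)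
          finally show ?thesis
            by (simp add: norm_blinfun.rep_eq minus_blinfun.rep_eq fun_diff_def)
        qed
      qed auto
      then have 2: "H x p' + Hx H x p' \<bullet> e - C * (norm e)\<^sup>2 \<le> H x' p'"
        unfolding Hx by (simp add: f_def e_def norm_Pair power2_eq_square algebra_simps abs_le_iff)
      have "(Hx H x p - Hx H x p') \<bullet> e \<le> norm (Hx H x p - Hx H x p') * norm e"
        by (rule norm_cauchy_schwarz)
      also have "\<dots> \<le> (C * norm d) * norm e"
        using Hx_lip[OF p, of x x] by (intro mult_right_mono) (auto simp: d_def norm_minus_commute)
      finally have 3: "Hx H x p \<bullet> e - C * norm d * norm e \<le> Hx H x p' \<bullet> e"
        by (simp add: inner_diff_left)
      show ?thesis
        using 1 2 3 unfolding d_def e_def by linarith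
    qed
  qed
qed

section \<open>Backward invariance\<close>

text \<open>With a = 1 / (2 \<delta>) this is the penalty of the sup-convolution, with gradient (y -
  x) / \<delta> at the touching point; the opposite sign of a serves the inf-convolution.\<close>

lemma quadratic_test_function:
  fixes x :: "'a::real_inner"
  shows "C1_map (\<lambda>z. a * (norm (z - x))\<^sup>2)"
    and "((\<lambda>z. a * (norm (z - x))\<^sup>2) has_derivative (\<lambda>k. ((2 * a) *\<^sub>R (y - x)) \<bullet> k)) (at y)"
proof -
  have der: "((\<lambda>z. a * (norm (z - x))\<^sup>2) has_derivative (\<lambda>k. ((2 * a) *\<^sub>R (y - x)) \<bullet> k)) (at y)" for y
    unfolding power2_norm_eq_inner
    by (auto intro!: derivative_eq_intros simp: inner_commute algebra_simps)
  then show "((\<lambda>z. a * (norm (z - x))\<^sup>2) has_derivative (\<lambda>k. ((2 * a) *\<^sub>R (y - x)) \<bullet> k)) (at y)" .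
  have "continuous_on UNIV (\<lambda>z. blinfun_inner_right ((2 * a) *\<^sub>R (z - x)))"
    by (intro bounded_linear.continuous_on[OF bounded_linear_blinfun_inner_right] continuous_intros)
  then show "C1_map (\<lambda>z. a * (norm (z - x))\<^sup>2)"
    unfolding C1_map_def using der
    by (intro exI[of _ "\<lambda>z. blinfun_inner_right ((2 * a) *\<^sub>R (z - x))"] conjI allI)
      (simp_all only: blinfun_inner_right.rep_eq)
qed

text \<open>The flow is encoded by its solution curves on \<open>{s..0}\<close>, lifted from the
  torus to the covering space; as \<open>v\<close> is periodic, membership in the graph does not
  depend on the lift.\<close>

theorem theorem3p3:
  fixes H :: "real ^ 'n \<Rightarrow> real ^ 'n \<Rightarrow> real"
    and c :: "real ^ 'n" and h \<epsilon> :: real and v :: "real ^ 'n \<Rightarrow> real"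
  assumes H_C2: "C2_map (\<lambda>z::(real ^ 'n) \<times> (real ^ 'n). H (fst z) (snd z))"
    and H_per: "\<And>x p k. int_vec k \<Longrightarrow> H (x + k) p = H x p"
    and H_convex: "Hpp_pos_def H"
    and H_superlin: "superlinear H"
    and h_crit: "\<And>a. (\<exists>u. torus_visc_sol (\<lambda>x r q. H x (c + q) - a) u) \<longleftrightarrow> a = h"
    and eps_pos: "\<epsilon> > 0"
    and v_sol: "torus_visc_sol (\<lambda>x r q. \<epsilon> * r + H x (c + q) - h) v"
    and v_lip: "\<exists>L. L-lipschitz_on UNIV v"
  shows "\<forall>s \<le> 0. \<forall>\<gamma> :: real \<Rightarrow> (real ^ 'n) \<times> (real ^ 'n).
           (\<forall>t \<in> {s..0}. (\<gamma> has_vector_derivative disc_field H c \<epsilon> (\<gamma> t)) (at t within {s..0}))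
           \<and> \<gamma> 0 \<in> graph_grad c v
           \<longrightarrow> \<gamma> s \<in> graph_grad c v"
proof (intro allI impI)
  fix s :: real and \<gamma> :: "real \<Rightarrow> (real ^ 'n) \<times> (real ^ 'n)"
  assume "s \<le> 0" and flow: "(\<forall>t \<in> {s..0}. (\<gamma> has_vector_derivative disc_field H c \<epsilon> (\<gamma> t)) (at t within {s..0}))
      \<and> \<gamma> 0 \<in> graph_grad c v"
  show "\<gamma> s \<in> graph_grad c v"
  proof (cases "s = 0")
    case True
    then show ?thesis
      using flow by simp
  next
    case False
    define T where "T = - s"
    have "0 < T"
      using False \<open>s \<le> 0\<close> by (simp add: T_def)
    define \<xi> where "\<xi> t = fst (\<gamma> (- t))" for t
    \<comment> \<open>Subtracting \<open>c\<close> turns the damping \<epsilon> c - \<epsilon> p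
      into - \<epsilon> \<rho> and makes \<rho> comparable with the gradient of \<open>v\<close>.
      Time is reversed to match the backward numbering of the nodes.\<close>
    define \<rho> where "\<rho> t = snd (\<gamma> (- t)) - c" for t
    have \<gamma>: "((\<lambda>t. \<gamma> (- t)) has_vector_derivative - disc_field H c \<epsilon> (\<gamma> (- t))) (at t within {0..T})"
      if "t \<in> {0..T}" for t
    proof -
      have "(uminus has_vector_derivative - 1) (at t within {0..T})"
        by (auto intro!: derivative_eq_intros)
      moreover have "(\<gamma> has_vector_derivative disc_field H c \<epsilon> (\<gamma> (- t))) (at (- t) within uminus ` {0..T})"
        using flow that by (auto simp: T_def)
      ultimately show ?thesis
        using vector_diff_chain_within by (force simp: o_def)
    qed
    have \<xi>: "(\<xi> has_vector_derivative - Hp H (\<xi> t) (c + \<rho> t)) (at t within {0..T})"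
      if "t \<in> {0..T}" for t
      using bounded_linear.has_vector_derivative[OF bounded_linear_fst \<gamma>[OF that]]
      by (simp add: \<xi>_def[abs_def] \<rho>_def disc_field_def)
    have \<rho>: "(\<rho> has_vector_derivative Hx H (\<xi> t) (c + \<rho> t) + \<epsilon> *\<^sub>R \<rho> t) (at t within {0..T})"
      if "t \<in> {0..T}" for t
      using has_vector_derivative_diff_const[of "\<lambda>t. snd (\<gamma> (- t))" c,
          THEN iffD2, OF bounded_linear.has_vector_derivative[OF bounded_linear_snd \<gamma>[OF that]]]
      by (simp add: \<rho>_def[abs_def] \<xi>_def disc_field_def algebra_simps)
    have "continuous_on {0..T} \<rho>"
      using \<rho> has_vector_derivative_continuous by (fastforce simp: continuous_on_eq_continuous_within)
    then have "bounded (\<rho> ` {0..T})"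
      by (intro compact_imp_bounded compact_continuous_image compact_Icc)
    then obtain R0 where "\<forall>q\<in>\<rho> ` {0..T}. norm q \<le> R0"
      unfolding bounded_iff by blast
    then have R0: "norm (\<rho> t) \<le> R0" if "t \<in> {0..T}" for t
      using that by blast
    obtain K where K: "K-lipschitz_on UNIV v"
      using v_lip by blast
    \<comment> \<open>\<open>2 * K\<close> accommodates the costates of the convolutions and
      \<open>R0\<close> the given characteristic. The bounds on \<open>H\<close> are then taken at
      radius \<open>norm c + R\<close>, since momenta are shifted by \<open>c\<close>.\<close>
    define R where "R = max (2 * K) R0"
    obtain C \<mu> where C: "0 \<le> C" "0 < \<mu>"
      and H1: "\<And>x y p. norm p \<le> norm c + R \<Longrightarrow> \<bar>H x p - H y p\<bar> \<le> C * norm (x - y)"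
      and H2: "\<And>x p. norm p \<le> norm c + R \<Longrightarrow> norm (Hx H x p) \<le> C"
      and H3: "\<And>x p. norm p \<le> norm c + R \<Longrightarrow> norm (Hp H x p) \<le> C"
      and H4: "\<And>x p x' p'. norm p \<le> norm c + R \<Longrightarrow> norm p' \<le> norm c + R \<Longrightarrow>
        norm (Hx H x p - Hx H x' p') \<le> C * (norm (x - x') + norm (p - p'))"
      and H5: "\<And>x p x' p'. norm p \<le> norm c + R \<Longrightarrow> norm p' \<le> norm c + R \<Longrightarrow>
        norm (Hp H x p - Hp H x' p') \<le> C * (norm (x - x') + norm (p - p'))"
      and H6: "\<And>x p x' p'. norm p \<le> norm c + R \<Longrightarrow> norm p' \<le> norm c + R \<Longrightarrow>
        H x p + Hp H x p \<bullet> (p' - p) + Hx H x p \<bullet> (x' - x) + \<mu> * (norm (p' - p))\<^sup>2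
          - C * norm (p' - p) * norm (x' - x) - C * (norm (x' - x))\<^sup>2 \<le> H x' p'"
      using hamiltonian_estimates[OF H_C2 H_per H_convex, of "norm c + R"] by blast
    have shift: "norm (c + q) \<le> norm c + R" if "norm q \<le> R" for q
      using norm_triangle_ineq[of c q] that by linarith
    interpret discounted_HJ "\<lambda>x q. H x (c + q) - h" "\<lambda>x q. Hx H x (c + q)" "\<lambda>x q. Hp H x (c + q)"
      v \<epsilon> K R C \<mu>
    proof
      show "0 \<le> K"
        using K by (rule lipschitz_on_nonneg)
      show "\<bar>v x - v y\<bar> \<le> K * norm (x - y)" for x y
        using lipschitz_onD[OF K, of x y] by (simp add: dist_norm)
      show "\<epsilon> * v y + (H y (c + (1 / \<delta>) *\<^sub>R (y - x)) - h) \<le> 0"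
        if "0 < \<delta>" and max: "\<And>z. v z - (norm (z - x))\<^sup>2 / (2 * \<delta>) \<le> v y - (norm (y - x))\<^sup>2 / (2 * \<delta>)"
        for \<delta> x y
      proof -
        have "\<forall>\<^sub>F z in at y. v z - 1 / (2 * \<delta>) * (norm (z - x))\<^sup>2 \<le> v y - 1 / (2 * \<delta>) * (norm (y - x))\<^sup>2"
          using max by (intro always_eventually) simp
        moreover have "visc_sub (\<lambda>x r q. \<epsilon> * r + H x (c + q) - h) v"
          using v_sol by (simp add: torus_visc_sol_def visc_sol_def)
        ultimately have "\<epsilon> * v y + H y (c + (2 * (1 / (2 * \<delta>))) *\<^sub>R (y - x)) - h \<le> 0"
          unfolding visc_sub_def using quadratic_test_function by blast
        then show ?thesis
          by simp
      qed
      show "0 \<le> \<epsilon> * v y + (H y (c + (1 / \<delta>) *\<^sub>R (x - y)) - h)"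
        if "0 < \<delta>" and min: "\<And>z. v y + (norm (y - x))\<^sup>2 / (2 * \<delta>) \<le> v z + (norm (z - x))\<^sup>2 / (2 * \<delta>)"
        for \<delta> x y
      proof -
        have "\<forall>\<^sub>F z in at y. v z - - 1 / (2 * \<delta>) * (norm (z - x))\<^sup>2 \<ge> v y - - 1 / (2 * \<delta>) * (norm (y - x))\<^sup>2"
          using min by (intro always_eventually) simp
        moreover have "visc_super (\<lambda>x r q. \<epsilon> * r + H x (c + q) - h) v"
          using v_sol by (simp add: torus_visc_sol_def visc_sol_def)
        \<comment> \<open>The test function touches from below, so its quadratic coefficient is
          negative and the gradient points from \<open>y\<close> towards \<open>x\<close>.\<close>
        ultimately have "\<epsilon> * v y + H y (c + (2 * (- 1 / (2 * \<delta>))) *\<^sub>R (y - x)) - h \<ge> 0"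
          unfolding visc_super_def using quadratic_test_function by blast
        moreover have "(2 * (- 1 / (2 * \<delta>))) *\<^sub>R (y - x) = (1 / \<delta>) *\<^sub>R (x - y)"
          by (simp add: algebra_simps)
        ultimately have "\<epsilon> * v y + H y (c + (1 / \<delta>) *\<^sub>R (x - y)) - h \<ge> 0"
          by (simp only:)
        then show ?thesis
          by simp
      qed
      show "H x (c + p) - h + Hp H x (c + p) \<bullet> (p' - p) + Hx H x (c + p) \<bullet> (x' - x) + \<mu> * (norm (p' - p))\<^sup>2
          - C * norm (p' - p) * norm (x' - x) - C * (norm (x' - x))\<^sup>2 \<le> H x' (c + p') - h"
        if "norm p \<le> R" "norm p' \<le> R" for x p x' p'
        using H6[OF shift[OF that(1)] shift[OF that(2)], of x x'] by simp
      show "norm (Hx H x (c + p) - Hx H x' (c + p')) \<le> C * (norm (x - x') + norm (p - p'))"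
        "norm (Hp H x (c + p) - Hp H x' (c + p')) \<le> C * (norm (x - x') + norm (p - p'))"
        if "norm p \<le> R" "norm p' \<le> R" for x p x' p'
        using H4[OF shift[OF that(1)] shift[OF that(2)], of x x']
          H5[OF shift[OF that(1)] shift[OF that(2)], of x x'] by simp_all
    qed (use C eps_pos H1 H2 H3 shift in \<open>auto simp: R_def\<close>)
    obtain x0 where x0: "\<gamma> 0 = (x0, c + grad v x0)" "v differentiable (at x0)"
      using flow by (auto simp: graph_grad_def)
    then have "(v has_derivative (\<lambda>k. grad v x0 \<bullet> k)) (at x0)"
      using inner_grad unfolding differentiable_def by (metis (no_types, lifting) ext)
    then have "(v has_derivative (\<lambda>k. \<rho> 0 \<bullet> k)) (at (\<xi> 0))"
      by (simp add: \<xi>_def \<rho>_def x0(1))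
    then have der: "(v has_derivative (\<lambda>k. \<rho> T \<bullet> k)) (at (\<xi> T))"
      using R0 by (intro gradient_along_characteristic[OF _ \<open>0 < T\<close> \<xi> \<rho>]) (auto simp: R_def le_max_iff_disj)
    then have "grad v (\<xi> T) = \<rho> T"
      using inner_grad[OF der] by (intro vector_eq_rdot[THEN iffD1]) auto
    moreover have "v differentiable (at (\<xi> T))"
      using der by (auto simp: differentiable_def)
    moreover have "\<gamma> s = (\<xi> T, c + \<rho> T)"
      by (simp add: \<xi>_def \<rho>_def T_def)
    ultimately show ?thesis
      unfolding graph_grad_def by force
  qed
qed

end
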